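(* Let $n\ge4$, let $Q$ be a Dynkin quiver of type $D_n$, and let $\gamma=\varepsilon_a+\varepsilon_b\in\Phi_n^+$ with $1\le a<b\le n-2$ (i.e. $\gamma$ is a positive root that is not multiplicity free). Then there exist $n-b-1$ many non-minimal pairs of $\gamma$.
   Context: Type $D_n$ and the AR-quiver. $\Delta_n$ ($n\ge4$) is the Dynkin diagram of type $D_n$ with vertex set $I_0=\{1,\dots,n\}$ and edges $i - (i+1)$ for $1\le i\le n-2$ and $(n-2) - n$. With $\varepsilon_1,\dots,\varepsilon_n$ orthonormal, $\alpha_i=\varepsilon_i-\varepsilon_{i+1}$ ($i\le n-1$), $\alpha_n=\varepsilon_{n-1}+\varepsilon_n$, and $\Phi_n^+=\{\varepsilon_a\pm\varepsilon_b : 1\le a<b\le n\}$. A Dynkin quiver $Q$ of type $D_n$ is an orientation of $\Delta_n$. Fix a height function $\xi:I_0\to\mathbb Z$, i.e. $\xi_j=\xi_i-1$ whenever $i\to j$ in $Q$. For $i\in I_0$ let $\eta_i=\sum_j\alpha_j$, the sum over all $j$ admitting a (possibly trivial) path from $j$ to $i$ in $Q$. Let $s_iQ$ be $Q$ with all arrows at $i$ reversed, and let $\tau=s_{i_1}\cdots s_{i_n}$ be the Coxeter element adapted to $Q$: $\{i_1,\dots,i_n\}=I_0$ and $i_k$ is a source of $s_{i_{k-1}}\cdots s_{i_1}Q$ for all $k$. Put $m_i=\max\{k\ge 0:\tau^k(\eta_i)\in\Phi_n^+\}$. The Auslander-Reiten quiver $\Gamma_Q$ has vertices $(i,\xi_i-2k)$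 with $i\in I_0$, $0\le k\le m_i$, and arrows $(i,p)\to(j,p+1)$ for $i,j$ adjacent in $\Delta_n$. Its vertices are identified with $\Phi_n^+$ by $(i,\xi_i-2k)\leftrightarrow\tau^k(\eta_i)$. Order and pairs. $\alpha\prec_Q\beta$ iff $\alpha\ne\beta$ and there is a path from $\beta$ to $\alpha$ in $\Gamma_Q$. A total order $<$ on $\Phi_n^+$ is compatible with $\prec_Q$ if $\alpha\prec_Q\beta$ implies $\alpha<\beta$. A pair of $\gamma\in\Phi_n^+$ is $(\alpha,\beta)$ with $\alpha,\beta\in\Phi_n^+$, $\alpha+\beta=\gamma$ and $\alpha\prec_Q\beta$. It is minimal with respect to $<$ if there is no pair $(\alpha',\beta')$ of $\gamma$ with $\alpha<\alpha'<\gamma<\beta'<\beta$. It is a non-minimal pair if it is not minimal with respect to any total order compatible with $\prec_Q$. A positive root $\sum_i n_i\alpha_i$ is multiplicity free if all $n_i\le1$; the positive roots that are not multiplicity free are exactly $\varepsilon_a+\varepsilon_b$ with $1\le a<b\le n-2$.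
   Formalization: The maximum defining m_i does not exist as written, since τ has finite order and so τ^k(η_i) is a positive root for infinitely many k; m_i is taken instead as the largest k such that τ^l(η_i) is a positive root for all 0≤l≤k. *)

theory Defs
  imports Complex_Main "HOL-Library.Function_Algebras"
begin

text \<open>
  Vectors of Euclidean \<open>n\<close>-space are functions \<open>nat \<Rightarrow> real\<close>, of which only the coordinates
  \<open>1, \<dots>, n\<close> matter; all vectors below vanish elsewhere. Addition is pointwise.
\<close>

type_synonym vec = "nat \<Rightarrow> real"

definition eps :: "nat \<Rightarrow> vec" where
  "eps i = (\<lambda>j. if j = i then 1 else 0)"

definition ip :: "nat \<Rightarrow> vec \<Rightarrow> vec \<Rightarrow> real" where
  "ip n u v = (\<Sum>i = 1..n. u i * v i)"

definition simple_root :: "nat \<Rightarrow> nat \<Rightarrow> vec" where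
  "simple_root n i = (if i = n then eps (n - 1) + eps n else eps i - eps (Suc i))"

definition pos_roots :: "nat \<Rightarrow> vec set" where
  "pos_roots n = {eps a + eps b | a b. 1 \<le> a \<and> a < b \<and> b \<le> n}
               \<union> {eps a - eps b | a b. 1 \<le> a \<and> a < b \<and> b \<le> n}"

definition simple_reflection :: "nat \<Rightarrow> nat \<Rightarrow> vec \<Rightarrow> vec" where
  "simple_reflection n i v =
     (let r = simple_root n i in v - (\<lambda>j. 2 * ip n v r / ip n r r * r j))"

definition dynkin_edges :: "nat \<Rightarrow> nat set set" where
  "dynkin_edges n = {{i, i + 1} | i. 1 \<le> i \<and> i \<le> n - 2} \<union> {{n - 2, n}}"

text \<open>A quiver is given by its set of arrows, \<open>(i, j)\<close> standing for \<open>i \<rightarrow> j\<close>.\<close>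

type_synonym quiver = "(nat \<times> nat) set"

definition dynkin_quiver :: "nat \<Rightarrow> quiver \<Rightarrow> bool" where
  "dynkin_quiver n Q \<longleftrightarrow>
     (\<forall>i j. (i, j) \<in> Q \<longrightarrow> {i, j} \<in> dynkin_edges n) \<and>
     (\<forall>i j. {i, j} \<in> dynkin_edges n \<longrightarrow> ((i, j) \<in> Q \<longleftrightarrow> (j, i) \<notin> Q))"

definition height_function :: "quiver \<Rightarrow> (nat \<Rightarrow> int) \<Rightarrow> bool" where
  "height_function Q \<xi> \<longleftrightarrow> (\<forall>i j. (i, j) \<in> Q \<longrightarrow> \<xi> j = \<xi> i - 1)"

definition eta :: "nat \<Rightarrow> quiver \<Rightarrow> nat \<Rightarrow> vec" where
  "eta n Q i = (\<Sum>j \<in> {j \<in> {1..n}. (j, i) \<in> Q\<^sup>*}. simple_root n j)"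

definition reverse_at :: "nat \<Rightarrow> quiver \<Rightarrow> quiver" where
  "reverse_at i Q = {(x, y) \<in> Q. x \<noteq> i \<and> y \<noteq> i} \<union> {(y, x) | x y. (x, y) \<in> Q \<and> (x = i \<or> y = i)}"

definition source :: "quiver \<Rightarrow> nat \<Rightarrow> bool" where
  "source Q i \<longleftrightarrow> (\<forall>j. (j, i) \<notin> Q)"

text \<open>
  Lists are indexed from \<open>0\<close>, so \<open>is ! k\<close> is the entry with number \<open>k + 1\<close>, and the fold reverses
  \<open>Q\<close> at the \<open>k\<close> entries before it, starting with the head of the list.
\<close>

definition adapted :: "nat \<Rightarrow> quiver \<Rightarrow> nat list \<Rightarrow> bool" where
  "adapted n Q is \<longleftrightarrow> distinct is \<and> set is = {1..n} \<and>
     (\<forall>k < length is. source (fold reverse_at (take k is) Q) (is ! k))"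

text \<open>The reflection at the last entry of the word acts first.\<close>

definition adapted_coxeter :: "nat \<Rightarrow> quiver \<Rightarrow> (vec \<Rightarrow> vec) \<Rightarrow> bool" where
  "adapted_coxeter n Q \<tau> \<longleftrightarrow> (\<exists>is. adapted n Q is \<and> \<tau> = foldr (simple_reflection n) is)"

text \<open>
  The maximum is over the initial run of exponents with positive image. As \<open>\<tau>\<close> has finite order,
  the set of all \<open>k\<close> with \<open>(\<tau> ^^ k) (eta n Q i)\<close> positive is infinite and has no maximum.
\<close>

definition ar_length :: "nat \<Rightarrow> quiver \<Rightarrow> (vec \<Rightarrow> vec) \<Rightarrow> nat \<Rightarrow> nat" where
  "ar_length n Q \<tau> i = Max {k. \<forall>l \<le> k. (\<tau> ^^ l) (eta n Q i) \<in> pos_roots n}"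

definition ar_vertices ::
    "nat \<Rightarrow> quiver \<Rightarrow> (nat \<Rightarrow> int) \<Rightarrow> (vec \<Rightarrow> vec) \<Rightarrow> (nat \<times> int) set" where
  "ar_vertices n Q \<xi> \<tau> = {(i, \<xi> i - 2 * int k) | i k. 1 \<le> i \<and> i \<le> n \<and> k \<le> ar_length n Q \<tau> i}"

definition ar_arrows ::
    "nat \<Rightarrow> quiver \<Rightarrow> (nat \<Rightarrow> int) \<Rightarrow> (vec \<Rightarrow> vec) \<Rightarrow> ((nat \<times> int) \<times> (nat \<times> int)) set" where
  "ar_arrows n Q \<xi> \<tau> = {((i, p), (j, p + 1)) | i j p.
     (i, p) \<in> ar_vertices n Q \<xi> \<tau> \<and> (j, p + 1) \<in> ar_vertices n Q \<xi> \<tau> \<and> {i, j} \<in> dynkin_edges n}"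

text \<open>
  The root identified with a vertex: on \<open>(i, \<xi> i - 2 * int k)\<close> the value is
  \<open>(\<tau> ^^ k) (eta n Q i)\<close>.
\<close>

definition ar_root ::
    "nat \<Rightarrow> quiver \<Rightarrow> (nat \<Rightarrow> int) \<Rightarrow> (vec \<Rightarrow> vec) \<Rightarrow> nat \<times> int \<Rightarrow> vec" where
  "ar_root n Q \<xi> \<tau> = (\<lambda>(i, p). (\<tau> ^^ nat ((\<xi> i - p) div 2)) (eta n Q i))"

definition prec ::
    "nat \<Rightarrow> quiver \<Rightarrow> (nat \<Rightarrow> int) \<Rightarrow> (vec \<Rightarrow> vec) \<Rightarrow> vec \<Rightarrow> vec \<Rightarrow> bool" where
  "prec n Q \<xi> \<tau> \<alpha> \<beta> \<longleftrightarrow> \<alpha> \<noteq> \<beta> \<and>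
     (\<exists>x \<in> ar_vertices n Q \<xi> \<tau>. \<exists>y \<in> ar_vertices n Q \<xi> \<tau>.
        ar_root n Q \<xi> \<tau> x = \<alpha> \<and> ar_root n Q \<xi> \<tau> y = \<beta> \<and> (y, x) \<in> (ar_arrows n Q \<xi> \<tau>)\<^sup>*)"

text \<open>\<open>(\<alpha>, \<beta>) \<in> R\<close> stands for \<open>\<alpha> < \<beta>\<close>; the order is strict.\<close>

definition compatible ::
    "nat \<Rightarrow> quiver \<Rightarrow> (nat \<Rightarrow> int) \<Rightarrow> (vec \<Rightarrow> vec) \<Rightarrow> vec rel \<Rightarrow> bool" where
  "compatible n Q \<xi> \<tau> R \<longleftrightarrow>
     R \<subseteq> pos_roots n \<times> pos_roots n \<and> strict_linear_order_on (pos_roots n) R \<and>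
     (\<forall>\<alpha> \<in> pos_roots n. \<forall>\<beta> \<in> pos_roots n. prec n Q \<xi> \<tau> \<alpha> \<beta> \<longrightarrow> (\<alpha>, \<beta>) \<in> R)"

definition root_pairs ::
    "nat \<Rightarrow> quiver \<Rightarrow> (nat \<Rightarrow> int) \<Rightarrow> (vec \<Rightarrow> vec) \<Rightarrow> vec \<Rightarrow> (vec \<times> vec) set" where
  "root_pairs n Q \<xi> \<tau> \<gamma> =
     {(\<alpha>, \<beta>). \<alpha> \<in> pos_roots n \<and> \<beta> \<in> pos_roots n \<and> \<alpha> + \<beta> = \<gamma> \<and> prec n Q \<xi> \<tau> \<alpha> \<beta>}"

definition minimal_pair ::
    "nat \<Rightarrow> quiver \<Rightarrow> (nat \<Rightarrow> int) \<Rightarrow> (vec \<Rightarrow> vec) \<Rightarrow> vec rel \<Rightarrow> vec \<Rightarrow> vec \<times> vec \<Rightarrow> bool" where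
  "minimal_pair n Q \<xi> \<tau> R \<gamma> = (\<lambda>(\<alpha>, \<beta>). (\<alpha>, \<beta>) \<in> root_pairs n Q \<xi> \<tau> \<gamma> \<and>
     \<not> (\<exists>(\<alpha>', \<beta>') \<in> root_pairs n Q \<xi> \<tau> \<gamma>.
          (\<alpha>, \<alpha>') \<in> R \<and> (\<alpha>', \<gamma>) \<in> R \<and> (\<gamma>, \<beta>') \<in> R \<and> (\<beta>', \<beta>) \<in> R))"

definition non_minimal_pairs ::
    "nat \<Rightarrow> quiver \<Rightarrow> (nat \<Rightarrow> int) \<Rightarrow> (vec \<Rightarrow> vec) \<Rightarrow> vec \<Rightarrow> (vec \<times> vec) set" where
  "non_minimal_pairs n Q \<xi> \<tau> \<gamma> =
     {p \<in> root_pairs n Q \<xi> \<tau> \<gamma>. \<forall>R. compatible n Q \<xi> \<tau> R \<longrightarrow> \<not> minimal_pair n Q \<xi> \<tau> R \<gamma> p}"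

end

theory Submission
  imports Defs
begin

text \<open>
  The idea is to give every positive root a pair of integer coordinates \<open>(k, l)\<close> in which the
  order \<open>\<prec>\<close> is the componentwise order, and then to compare the finitely many kinds of pairs
  of \<open>\<gamma>\<close>.

  Put \<open>m = n - 1\<close>. The Coxeter element \<open>\<tau>\<close> permutes the vectors \<open>\<plusminus>\<epsilon>\<^sub>i\<close>. It negates
  one of \<open>\<epsilon>\<^sub>n\<^sub>-\<^sub>1\<close>, \<open>\<epsilon>\<^sub>n\<close>, and the remaining ones form, up to sign, a single cycle
  \<open>v 0, v 1, \<dots>\<close> with \<open>\<tau> (v q) = v (q + 1)\<close> and \<open>v (q + m) = - v q\<close>. The order of the cycle is
  read off from the orientation: going through the vertices \<open>1, 2, \<dots>\<close>, each \<open>\<epsilon>\<^sub>i\<close> is attached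
  at the right end of the interval occupied so far if \<open>i - 1 \<rightarrow> i\<close>, and at its left end otherwise.
  With this order, \<open>\<eta>\<^sub>i = v k - v (k + i)\<close> for \<open>i \<le> n - 2\<close>, where \<open>k\<close> is the left end after
  \<open>i\<close> steps (lemma \<open>eta_eq\<close>). Hence row \<open>i\<close> of the Auslander-Reiten quiver consists of roots
  \<open>v k - v l\<close> with \<open>l - k = i\<close>; the two remaining rows consist of \<open>v k\<close> plus or minus the negated
  basis vector, to which we give the coordinates \<open>(k, k + m)\<close>. The height of a vertex is a constant
  minus \<open>k + l\<close>, so that an arrow lowers exactly one of the coordinates by one
  (lemma \<open>arrow_coords\<close>).

  Let \<open>\<gamma> = \<epsilon>\<^sub>a + \<epsilon>\<^sub>b\<close> have coordinates \<open>(s, t)\<close>. For every \<open>c > b\<close> whose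
  \<open>\<epsilon>\<^sub>c\<close> lies on the cycle there are two pairs with summands \<open>\<epsilon>\<^sub>a \<plusminus> \<epsilon>\<^sub>c\<close> and
  \<open>\<epsilon>\<^sub>b \<mp> \<epsilon>\<^sub>c\<close>. For some \<open>u\<close> with \<open>s < u < t\<close>, one has coordinates \<open>(s, u), (u, t)\<close>, the
  other \<open>(t - m, u), (u, s + m)\<close>, and there is a path
  \<open>(u, s + m) \<rightarrow> (u, t) \<rightarrow> (s, t) \<rightarrow> (s, u) \<rightarrow> (t - m, u)\<close> along which only one coordinate
  changes at a time. So the second pair encloses the first one in every compatible order: this
  gives \<open>m - b = n - b - 1\<close> non-minimal pairs (lemma \<open>outer_pair_non_minimal\<close>). The coordinates of
  all other pairs of \<open>\<gamma>\<close> are such that no pair lies strictly between their members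
  (lemma \<open>inner_kind_minimal\<close>). For such a pair \<open>(\<alpha>, \<beta>)\<close>, a linear extension in which nothing
  lies between \<open>\<alpha>\<close> and \<open>\<beta>\<close> except the roots that have to, is a compatible order for
  which the pair is minimal (lemma \<open>linear_extension_with_interval\<close>).
\<close>

section \<open>Linear extensions with a prescribed interval\<close>

text \<open>
  List the elements of the down-set of \<open>\<beta>\<close> that are not above \<open>\<alpha>\<close>, then the closed interval
  from \<open>\<alpha>\<close> to \<open>\<beta>\<close>, then everything else. These blocks respect the partial order, and inside a
  block the rank does. The rank makes the order easy to extend on infinite carriers too: only ties
  are left, and an arbitrary well-order of the type breaks them.
\<close>

lemma linear_extension_with_interval:
  fixes A :: "'a set" and less :: "'a \<Rightarrow> 'a \<Rightarrow> bool" and rank :: "'a \<Rightarrow> int"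
  assumes less_trans: "\<And>x y z. less x y \<Longrightarrow> less y z \<Longrightarrow> less x z"
    and less_rank: "\<And>x y. less x y \<Longrightarrow> rank x < rank y"
    and "less \<alpha> \<beta>"
  obtains R where "R \<subseteq> A \<times> A" "strict_linear_order_on A R"
    "\<forall>x\<in>A. \<forall>y\<in>A. less x y \<longrightarrow> (x, y) \<in> R"
    "\<forall>x. (\<alpha>, x) \<in> R \<and> (x, \<beta>) \<in> R \<longrightarrow> less \<alpha> x \<and> less x \<beta>"
proof -
  obtain W :: "'a rel" where W: "Well_order W" "Field W = UNIV"
    using well_ordering by metis
  then have W_trans: "trans W" and W_antisym: "antisym W" and W_total: "total W"
    by (auto simp: well_order_on_def linear_order_on_def partial_order_on_def preorder_on_def)
  define block :: "'a \<Rightarrow> int" where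
    "block x = (if x = \<beta> \<or> less x \<beta> then (if x = \<alpha> \<or> less \<alpha> x then 1 else 0) else 2)" for x
  define below where "below x y \<longleftrightarrow> block x < block y \<or> block x = block y \<and>
      (rank x < rank y \<or> rank x = rank y \<and> (x, y) \<in> W \<and> x \<noteq> y)" for x y
  define R where "R = {(x, y). x \<in> A \<and> y \<in> A \<and> below x y}"
  have below_trans: "below x z" if "below x y" "below y z" for x y z
  proof -
    have "(x, z) \<in> W \<and> x \<noteq> z" if "(x, y) \<in> W" "x \<noteq> y" "(y, z) \<in> W"
      using that transD[OF W_trans] antisymD[OF W_antisym] by blast
    then show ?thesis using that unfolding below_def by linarith
  qed
  have below_irrefl: "\<not> below x x" for x by (simp add: below_def)
  have below_total: "x = y \<or> below x y \<or> below y x" for x y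
    using W_total unfolding below_def total_on_def by (metis UNIV_I linorder_neqE)
  have block_mono: "block x \<le> block y" if "less x y" for x y
    using that less_trans[of x y \<beta>] less_trans[of \<alpha> x y] unfolding block_def by auto
  show thesis
  proof (rule that[of R])
    show "R \<subseteq> A \<times> A" by (auto simp: R_def)
    show "strict_linear_order_on A R"
      unfolding strict_linear_order_on_def
    proof (intro conjI)
      show "trans R" using below_trans by (auto simp: R_def intro!: transI)
      show "irrefl R" using below_irrefl by (auto simp: R_def irrefl_def)
      show "total_on A R" using below_total by (auto simp: R_def total_on_def)
    qed
    have "(x, y) \<in> R" if "x \<in> A" "y \<in> A" "less x y" for x y
      using that block_mono[of x y] less_rank[of x y] by (auto simp: R_def below_def)
    then show "\<forall>x\<in>A. \<forall>y\<in>A. less x y \<longrightarrow> (x, y) \<in> R" by simp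
    show "\<forall>x. (\<alpha>, x) \<in> R \<and> (x, \<beta>) \<in> R \<longrightarrow> less \<alpha> x \<and> less x \<beta>"
    proof (intro allI impI)
      fix x assume "(\<alpha>, x) \<in> R \<and> (x, \<beta>) \<in> R"
      have "block \<alpha> = 1" "block \<beta> = 1" using \<open>less \<alpha> \<beta>\<close> by (auto simp: block_def)
      moreover have "below \<alpha> x" "below x \<beta>" using \<open>_ \<and> _\<close> by (auto simp: R_def)
      ultimately have "block x = 1" "x \<noteq> \<alpha>" "x \<noteq> \<beta>"
        using below_irrefl unfolding below_def by auto
      then show "less \<alpha> x \<and> less x \<beta>" by (auto simp: block_def split: if_splits)
    qed
  qed
qed

section \<open>The Coxeter element\<close>

lemma edge_iff:
  "{i, j} \<in> dynkin_edges n \<longleftrightarrow>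
     (j = Suc i \<and> 1 \<le> i \<and> i \<le> n - 2) \<or> (i = Suc j \<and> 1 \<le> j \<and> j \<le> n - 2) \<or>
     (i = n - 2 \<and> j = n) \<or> (i = n \<and> j = n - 2)"
  by (auto simp: dynkin_edges_def doubleton_eq_iff)

lemma ip_eps: "ip n x (eps i) = (if i \<in> {1..n} then x i else 0)"
  by (simp add: ip_def eps_def if_distrib cong: if_cong)

lemma ip_add_right: "ip n x (y + z) = ip n x y + ip n x z"
  by (simp add: ip_def algebra_simps sum.distrib)

lemma ip_diff_right: "ip n x (y - z) = ip n x y - ip n x z"
  by (simp add: ip_def algebra_simps sum_subtractf)

lemma ip_simple_root:
  assumes "n \<ge> 2" "i \<in> {1..n}"
  shows "ip n x (simple_root n i) = (if i = n then x (n - 1) + x n else x i - x (Suc i))"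
  using assms by (auto simp: simple_root_def ip_add_right ip_diff_right ip_eps)

lemma ip_simple_roots:
  assumes "n \<ge> 4" "i \<in> {1..n}" "j \<in> {1..n}"
  shows "ip n (simple_root n i) (simple_root n j) =
    (if i = j then 2 else if {i, j} \<in> dynkin_edges n then -1 else 0)"
proof -
  have "n = Suc (Suc (Suc (Suc (n - 4))))" using assms(1) by simp
  then obtain k where k: "n = Suc (Suc (Suc (Suc k)))" by blast
  have "ip n (simple_root n i) (simple_root n j) = (if j = n
      then simple_root n i (n - 1) + simple_root n i n else simple_root n i j - simple_root n i (Suc j))"
    using assms by (simp add: ip_simple_root)
  also have "\<dots> = (if i = j then 2 else if {i, j} \<in> dynkin_edges n then -1 else 0)"
  proof (cases "i = n"; cases "j = n")
    assume "i \<noteq> n" "j \<noteq> n"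
    consider "i = j" | "j = Suc i" | "i = Suc j" | "i \<noteq> j" "j \<noteq> Suc i" "i \<noteq> Suc j" by blast
    then show ?thesis using assms(2,3) \<open>i \<noteq> n\<close> \<open>j \<noteq> n\<close> unfolding edge_iff k
      by cases (simp_all add: simple_root_def eps_def)
  qed (use assms(2,3) in \<open>auto simp: edge_iff k simple_root_def eps_def\<close>)
  finally show ?thesis .
qed

lemma simple_reflection_apply:
  assumes "n \<ge> 4" "i \<in> {1..n}"
  shows "simple_reflection n i x t = x t - ip n x (simple_root n i) * simple_root n i t"
  using assms ip_simple_roots[of n i i] by (simp add: simple_reflection_def Let_def)

lemma ip_simple_reflection:
  assumes "n \<ge> 4" "i \<in> {1..n}"
  shows "ip n (simple_reflection n i x) y =
    ip n x y - ip n x (simple_root n i) * ip n (simple_root n i) y"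
  unfolding ip_def[of n "simple_reflection n i x" y] simple_reflection_apply[OF assms]
  by (simp add: ip_def[of n x y] ip_def[of n "simple_root n i" y] left_diff_distrib
      sum_subtractf sum_distrib_left mult.assoc)

lemma arrow_in_fold_reverse_at:
  "(x, y) \<in> Q \<Longrightarrow> x \<notin> set w \<Longrightarrow> y \<notin> set w \<Longrightarrow> (x, y) \<in> fold reverse_at w Q"
proof (induction w arbitrary: Q)
  case (Cons i w)
  then have "(x, y) \<in> reverse_at i Q" by (auto simp: reverse_at_def)
  with Cons show ?case by simp
qed simp

text \<open>
  An arrow between two letters that have not been used yet is still unreversed. So a predecessor of
  a letter must have been used before that letter becomes a source, and a neighbour used before it
  cannot be a successor, since it would then have had to come later.
\<close>

lemma adapted_neighbours_before:
  assumes Q: "dynkin_quiver n Q" and ad: "adapted n Q w" and k: "k < length w"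
    and x: "{w ! k, x} \<in> dynkin_edges n"
  shows "x \<in> set (take k w) \<longleftrightarrow> (x, w ! k) \<in> Q"
proof -
  have dist: "distinct w" using ad by (simp add: adapted_def)
  have preds: "y \<in> set (take j w)" if "(y, w ! j) \<in> Q" "j < length w" for y j
  proof (rule ccontr)
    assume "y \<notin> set (take j w)"
    moreover have "w ! j \<notin> set (take j w)"
      using dist that(2) by (auto simp: in_set_conv_nth nth_eq_iff_index_eq)
    ultimately have "(y, w ! j) \<in> fold reverse_at (take j w) Q"
      using that(1) by (simp add: arrow_in_fold_reverse_at)
    then show False using ad that(2) by (auto simp: adapted_def source_def)
  qed
  show ?thesis
  proof
    assume "x \<in> set (take k w)"
    then obtain j where j: "j < k" "x = w ! j" using k by (auto simp: in_set_conv_nth)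
    have "(w ! k, w ! j) \<notin> Q"
    proof
      assume "(w ! k, w ! j) \<in> Q"
      then have "w ! k \<in> set (take j w)" using preds j k by auto
      then show False using dist j k by (auto simp: in_set_conv_nth nth_eq_iff_index_eq)
    qed
    then show "(x, w ! k) \<in> Q" using Q x j unfolding dynkin_quiver_def by blast
  qed (use preds k in blast)
qed

text \<open>
  Let \<open>w\<close> be the adapted word and let \<open>\<beta> k\<close> be the image of its \<open>k\<close>-th simple root under the
  product of the reflections before it. Splitting off the last reflection of a prefix shows that
  the prefix maps \<open>x\<close> to \<open>x\<close> minus the sum of \<open>(x, \<alpha>\<^sub>i) \<beta>\<close> over its entries \<open>i\<close>. Applied to
  \<open>x = \<alpha>\<^sub>i\<close>, this says that \<open>\<beta>\<close> satisfies the recursion assumed of \<open>e\<close>, because the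
  neighbours of \<open>i\<close> that occur earlier are exactly its predecessors in \<open>Q\<close>. So \<open>\<tau>\<close> does not
  depend on the word, and the formula gives it on any vector without multiplying out reflections.
\<close>

lemma coxeter_element_apply:
  fixes e :: "nat \<Rightarrow> vec"
  assumes n: "n \<ge> 4" and Q: "dynkin_quiver n Q" and cox: "adapted_coxeter n Q \<tau>"
    and e: "\<And>i t. i \<in> {1..n} \<Longrightarrow> e i t = simple_root n i t + (\<Sum>j | (j, i) \<in> Q. e j t)"
  shows "\<tau> x t = x t - (\<Sum>i = 1..n. ip n x (simple_root n i) * e i t)"
proof -
  obtain w where ad: "adapted n Q w" and \<tau>: "\<tau> = foldr (simple_reflection n) w"
    using cox by (auto simp: adapted_coxeter_def)
  have dist: "distinct w" and set_w: "set w = {1..n}" using ad by (auto simp: adapted_def)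
  have "foldr (simple_reflection n) (take k w) x t =
      x t - (\<Sum>i\<in>set (take k w). ip n x (simple_root n i) * e i t)" if "k \<le> length w" for k x
    using that
  proof (induction k arbitrary: x)
    case (Suc k)
    define i where "i = w ! k"
    have k: "k < length w" using Suc by simp
    have take: "take (Suc k) w = take k w @ [i]" using k by (simp add: i_def take_Suc_conv_app_nth)
    have i: "i \<in> {1..n}" using nth_mem[OF k] set_w by (simp add: i_def)
    have sub: "set (take k w) \<subseteq> {1..n}" using set_w set_take_subset[of k w] by simp
    have fresh: "i \<notin> set (take k w)"
      using dist k by (auto simp: i_def in_set_conv_nth nth_eq_iff_index_eq)
    define P where "P = {j. (j, i) \<in> Q}"
    have P: "P = {j \<in> set (take k w). {i, j} \<in> dynkin_edges n}"
    proof -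
      have "{i, j} \<in> dynkin_edges n" if "(j, i) \<in> Q" for j
        using Q that unfolding dynkin_quiver_def by (metis insert_commute)
      then show ?thesis using adapted_neighbours_before[OF Q ad k] unfolding P_def i_def by blast
    qed
    have "(\<Sum>j\<in>set (take k w). ip n (simple_root n i) (simple_root n j) * e j t)
        = (\<Sum>j\<in>set (take k w). if {i, j} \<in> dynkin_edges n then - e j t else 0)"
      using sub fresh i n by (intro sum.cong) (auto simp: ip_simple_roots)
    also have "\<dots> = - (\<Sum>j\<in>P. e j t)"
      unfolding P by (simp add: sum.If_cases Int_def sum_negf)
    finally have neighbours:
      "(\<Sum>j\<in>set (take k w). ip n (simple_root n i) (simple_root n j) * e j t) = - (\<Sum>j\<in>P. e j t)" .
    have "foldr (simple_reflection n) (take (Suc k) w) x t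
        = foldr (simple_reflection n) (take k w) (simple_reflection n i x) t" by (simp add: take)
    also have "\<dots> = simple_reflection n i x t -
        (\<Sum>j\<in>set (take k w). ip n (simple_reflection n i x) (simple_root n j) * e j t)"
      using Suc by simp
    also have "(\<Sum>j\<in>set (take k w). ip n (simple_reflection n i x) (simple_root n j) * e j t)
        = (\<Sum>j\<in>set (take k w). ip n x (simple_root n j) * e j t)
          - ip n x (simple_root n i) *
            (\<Sum>j\<in>set (take k w). ip n (simple_root n i) (simple_root n j) * e j t)"
      by (simp add: ip_simple_reflection[OF n i] left_diff_distrib sum_subtractf
          sum_distrib_left mult.assoc)
    also have "simple_reflection n i x t = x t - ip n x (simple_root n i) * simple_root n i t"
      by (rule simple_reflection_apply[OF n i])
    finally show ?case
      using e[OF i, of t] fresh unfolding neighbours P_def[symmetric]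
      by (simp add: take algebra_simps)
  qed simp
  from this[of "length w" x] show ?thesis using set_w \<tau> by simp
qed

section \<open>The ancestor sums \<open>\<eta>\<close>\<close>

lemma height_along_path:
  assumes "height_function Q \<xi>" "(x, y) \<in> Q\<^sup>*"
  shows "\<xi> y \<le> \<xi> x"
  using assms(2)
proof induction
  case (step y z)
  then have "\<xi> z = \<xi> y - 1" using assms(1) by (auto simp: height_function_def)
  with step show ?case by simp
qed simp

text \<open>
  For \<open>x \<noteq> i\<close>, this is the neighbour of \<open>i\<close> through which the way from \<open>i\<close> to \<open>x\<close> in the tree
  begins.
\<close>

definition branch :: "nat \<Rightarrow> nat \<Rightarrow> nat \<Rightarrow> nat" where
  "branch n i x = (if x < i then (if i = n then n - 2 else i - 1)
     else if i = n - 1 then n - 2 else if i = n - 2 then x else Suc i)"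

lemma branch_neighbour:
  assumes "n \<ge> 4" "{j, i} \<in> dynkin_edges n"
  shows "branch n i j = j"
proof -
  have "n = Suc (Suc (Suc (Suc (n - 4))))" using assms(1) by simp
  then obtain k where k: "n = Suc (Suc (Suc (Suc k)))" by blast
  show ?thesis using assms(2) unfolding edge_iff k branch_def by (elim disjE conjE) simp_all
qed

lemma branch_edge:
  assumes "n \<ge> 4" "{x, y} \<in> dynkin_edges n" "x \<noteq> i" "y \<noteq> i" "i \<le> n"
  shows "branch n i x = branch n i y"
proof -
  have "n = Suc (Suc (Suc (Suc (n - 4))))" using assms(1) by simp
  then obtain k where k: "n = Suc (Suc (Suc (Suc k)))" by blast
  show ?thesis using assms(2-) unfolding edge_iff k branch_def by (elim disjE conjE; simp; linarith?)
qed

text \<open>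
  The ancestors of \<open>i\<close> are \<open>i\<close> and the ancestors of its predecessors. The latter sets are disjoint:
  along a directed path to a predecessor of \<open>i\<close> the height stays above that of \<open>i\<close>, so the path
  avoids \<open>i\<close> and stays in one branch at \<open>i\<close>.
\<close>

lemma eta_recursion:
  assumes n: "n \<ge> 4" and Q: "dynkin_quiver n Q" and \<xi>: "height_function Q \<xi>"
    and i: "i \<in> {1..n}"
  shows "eta n Q i t = simple_root n i t + (\<Sum>j | (j, i) \<in> Q. eta n Q j t)"
proof -
  define anc where "anc i = {j \<in> {1..n}. (j, i) \<in> Q\<^sup>*}" for i
  have edge: "{x, y} \<in> dynkin_edges n" if "(x, y) \<in> Q" for x y
    using Q that unfolding dynkin_quiver_def by blast
  have vertex: "x \<in> {1..n}" if "(x, y) \<in> Q" for x y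
    using edge[OF that] n unfolding edge_iff by auto
  have drop: "\<xi> y = \<xi> x - 1" if "(x, y) \<in> Q" for x y
    using \<xi> that by (auto simp: height_function_def)
  have branch: "branch n i x = j" if path: "(x, j) \<in> Q\<^sup>*" and "(j, i) \<in> Q" for x j
    using path
  proof (induction rule: converse_rtrancl_induct)
    case base
    show ?case using branch_neighbour n edge that(2) by blast
  next
    case (step x y)
    have "(x, j) \<in> Q\<^sup>*" using step by simp
    then have "\<xi> x > \<xi> i" "\<xi> y > \<xi> i"
      using step height_along_path[OF \<xi>, of x j] height_along_path[OF \<xi>, of y j] drop that(2) by auto
    then show ?case using branch_edge[OF n edge[OF step(1)], of i] i step by auto
  qed
  have fin: "finite {j. (j, i) \<in> Q}"
    by (rule finite_subset[of _ "{1..n}"]) (use vertex in auto)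
  have fin_anc: "finite (anc j)" for j by (simp add: anc_def)
  have anc: "anc i = insert i (\<Union>j\<in>{j. (j, i) \<in> Q}. anc j)"
    using i unfolding anc_def by (auto elim: rtranclE intro: rtrancl_into_rtrancl)
  have "i \<notin> (\<Union>j\<in>{j. (j, i) \<in> Q}. anc j)"
    using drop height_along_path[OF \<xi>] unfolding anc_def by fastforce
  moreover have "(\<Sum>x\<in>(\<Union>j\<in>{j. (j, i) \<in> Q}. anc j). simple_root n x t)
      = (\<Sum>j | (j, i) \<in> Q. \<Sum>x\<in>anc j. simple_root n x t)"
    by (rule sum.UNION_disjoint) (use fin fin_anc branch in \<open>auto simp: anc_def\<close>)
  ultimately have "(\<Sum>x\<in>anc i. simple_root n x t)
      = simple_root n i t + (\<Sum>j | (j, i) \<in> Q. \<Sum>x\<in>anc j. simple_root n x t)"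
    using fin fin_anc by (subst anc) simp
  moreover have "eta n Q j t = (\<Sum>x\<in>anc j. simple_root n x t)" for j
    unfolding eta_def anc_def by (induction rule: infinite_finite_induct) auto
  ultimately show ?thesis by simp
qed

text \<open>
  Heights go up towards predecessors, so the recursion is well-founded.
\<close>

lemma eta_unique:
  fixes e :: "nat \<Rightarrow> vec"
  assumes n: "n \<ge> 4" and Q: "dynkin_quiver n Q" and \<xi>: "height_function Q \<xi>"
    and e: "\<And>i t. i \<in> {1..n} \<Longrightarrow> e i t = simple_root n i t + (\<Sum>j | (j, i) \<in> Q. e j t)"
    and i: "i \<in> {1..n}"
  shows "eta n Q i = e i"
proof
  fix t
  have bound: "\<xi> j \<le> Max (\<xi> ` {1..n})" if "j \<in> {1..n}" for j using that by simp
  show "eta n Q i t = e i t" using i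
  proof (induction "nat (Max (\<xi> ` {1..n}) - \<xi> i)" arbitrary: i rule: less_induct)
    case less
    have "eta n Q j t = e j t" if "(j, i) \<in> Q" for j
    proof (rule less.hyps)
      show j: "j \<in> {1..n}" using Q n that unfolding dynkin_quiver_def edge_iff by fastforce
      have "\<xi> i = \<xi> j - 1" using \<xi> that by (auto simp: height_function_def)
      then show "nat (Max (\<xi> ` {1..n}) - \<xi> j) < nat (Max (\<xi> ` {1..n}) - \<xi> i)"
        using bound[OF j] by linarith
    qed
    then show ?case using e eta_recursion[OF n Q \<xi>] less.prems by simp
  qed
qed

section \<open>Orders grown at both ends of an interval\<close>

text \<open>
  The numbers \<open>1, 2, \<dots>\<close> are placed on the integer line one after the other, so that the first
  \<open>i\<close> always fill the interval from \<open>lo R i\<close> up to and excluding \<open>lo R i + i\<close>; the number \<open>i\<close> is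
  attached at the right if \<open>R i\<close> and at the left otherwise, and \<open>pos R i\<close> is its place.
\<close>

fun lo :: "(nat \<Rightarrow> bool) \<Rightarrow> nat \<Rightarrow> int" where
  "lo R 0 = 0"
| "lo R (Suc i) = (if R (Suc i) then lo R i else lo R i - 1)"

definition pos :: "(nat \<Rightarrow> bool) \<Rightarrow> nat \<Rightarrow> int" where
  "pos R i = (if R i then lo R (i - 1) + int (i - 1) else lo R i)"

lemma lo_antimono: "i \<le> j \<Longrightarrow> lo R j \<le> lo R i"
  by (induction rule: dec_induct) auto

lemma lo_plus_mono: "i \<le> j \<Longrightarrow> lo R i + int i \<le> lo R j + int j"
  by (induction rule: dec_induct) auto

lemma pos_image: "pos R ` {1..i} = {lo R i..<lo R i + int i}"
proof (induction i)
  case (Suc i)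
  have "pos R ` {1..Suc i} = insert (pos R (Suc i)) (pos R ` {1..i})"
    by (simp add: atLeastAtMostSuc_conv)
  also have "\<dots> = {lo R (Suc i)..<lo R (Suc i) + int (Suc i)}"
    unfolding Suc by (auto simp: pos_def)
  finally show ?case .
qed simp

lemma inj_on_pos: "inj_on (pos R) {1..i}"
  by (rule eq_card_imp_inj_on) (simp, unfold pos_image, simp)

lemma pos_eq_iff: "1 \<le> x \<Longrightarrow> 1 \<le> y \<Longrightarrow> pos R x = pos R y \<longleftrightarrow> x = y"
  using inj_on_eq_iff[OF inj_on_pos[of R "max x y"], of x y] by simp

lemma pos_bounds:
  assumes "1 \<le> x" "x \<le> i"
  shows "lo R i \<le> pos R x" "pos R x < lo R i + int i"
proof -
  have "pos R x \<in> {lo R i..<lo R i + int i}" unfolding pos_image[symmetric] using assms by auto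
  then show "lo R i \<le> pos R x" "pos R x < lo R i + int i" by auto
qed

lemma pos_onto:
  assumes "lo R i \<le> q" "q < lo R i + int i"
  obtains x where "1 \<le> x" "x \<le> i" "q = pos R x"
proof -
  have "q \<in> pos R ` {1..i}" unfolding pos_image using assms by simp
  then show thesis using that by auto
qed

lemma pos_outside:
  assumes "1 \<le> x" "x < y"
  shows "pos R x < pos R y \<and> pos R y = lo R (y - 1) + int (y - 1) \<or>
    pos R y < pos R x \<and> pos R y = lo R (y - 1) - 1"
proof -
  obtain z where "y = Suc z" using assms by (cases y) auto
  then show ?thesis using assms pos_bounds[of x z R] by (auto simp: pos_def)
qed

text \<open>
  The next four lemmas decide which differences are positive. Extend the places antiperiodically,
  so that \<open>y\<close> at place \<open>q\<close> appears as \<open>- y\<close> at place \<open>q + m\<close>, and slide a window of length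
  \<open>r\<close> to the right, starting from the one that holds the \<open>r\<close> smallest numbers. For
  the first \<open>m\<close> windows, the entry at their left end \<open>k\<close> minus the entry at \<open>k + r\<close> is a difference \<open>x - y\<close> with \<open>x < y\<close> or a sum \<open>x + y\<close>, and
  all of these occur. The reason is that a larger number always lies beyond the interval filled by
  the smaller ones, so the initial window of length \<open>r\<close> is nested with that interval.
\<close>

lemma window_rightward:
  assumes "1 \<le> x" "x < y" "y \<le> m" "pos R x < pos R y"
    and r: "int r = pos R y - pos R x"
  shows "lo R r \<le> pos R x" "pos R x < lo R r + int m" "r < m"
proof -
  have y: "pos R y = lo R (y - 1) + int (y - 1)" using assms pos_outside[of x y R] by auto
  have x: "lo R (y - 1) \<le> pos R x" using assms pos_bounds[of x "y - 1" R] by auto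
  have ry: "r \<le> y - 1" using x y r by linarith
  then show "lo R r \<le> pos R x" using lo_plus_mono[of r "y - 1" R] r y by linarith
  show "r < m" using ry assms by linarith
  then show "pos R x < lo R r + int m"
    using lo_antimono[of r m R] pos_bounds[of x m R] assms by auto
qed

lemma window_leftward:
  assumes "1 \<le> x" "x < y" "y \<le> m" "pos R y < pos R x"
    and r: "int r = pos R x - pos R y"
  shows "lo R r \<le> pos R y + int m" "pos R y < lo R r" "r < m"
proof -
  have y: "pos R y = lo R (y - 1) - 1" using assms pos_outside[of x y R] by auto
  have x: "pos R x < lo R (y - 1) + int (y - 1)" using assms pos_bounds[of x "y - 1" R] by auto
  have ry: "r \<le> y - 1" using x y r by linarith
  then show "pos R y < lo R r" using lo_antimono[of r "y - 1" R] y by linarith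
  show "r < m" using ry assms by linarith
  then show "lo R r \<le> pos R y + int m"
    using lo_plus_mono[of r m R] pos_bounds[of y m R] assms by auto
qed

lemma window_across:
  assumes "1 \<le> x" "x \<le> m" "1 \<le> y" "y \<le> m" "pos R y < pos R x"
    and r: "int r = pos R y + int m - pos R x"
  shows "lo R r \<le> pos R x" "pos R x < lo R r + int m" "r < m"
proof -
  show "r < m" using assms by linarith
  then show "lo R r \<le> pos R x" using lo_plus_mono[of r m R] pos_bounds[of y m R] assms by auto
  show "pos R x < lo R r + int m"
    using lo_antimono[of r m R] pos_bounds[of x m R] assms \<open>r < m\<close> by auto
qed

lemma window_cases:
  assumes "1 \<le> r" "r < m" "lo R r \<le> k" "k < lo R r + int m"
  obtains (right) x y where "1 \<le> x" "x < y" "y \<le> m" "pos R x < pos R y"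
      "k = pos R x" "k + int r = pos R y"
    | (across) x y where "1 \<le> x" "x \<le> m" "1 \<le> y" "y \<le> m" "pos R y < pos R x"
      "k = pos R x" "k + int r = pos R y + int m"
    | (left) x y where "1 \<le> x" "x < y" "y \<le> m" "pos R y < pos R x"
      "k = pos R y + int m" "k + int r = pos R x + int m"
proof -
  have L: "lo R m \<le> lo R r" "lo R r + int r \<le> lo R m + int m"
    using lo_antimono[of r m R] lo_plus_mono[of r m R] assms by auto
  show thesis
  proof (cases "k < lo R m + int m")
    case True
    have "lo R m \<le> k" using L assms by linarith
    with True obtain x where x: "1 \<le> x" "x \<le> m" "k = pos R x" using pos_onto by metis
    show thesis
    proof (cases "k + int r < lo R m + int m")
      case True
      have "lo R m \<le> k + int r" using L assms by linarith
      with True obtain y where y: "1 \<le> y" "y \<le> m" "k + int r = pos R y" using pos_onto by metis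
      have lt: "pos R x < pos R y" using x y assms by linarith
      have "x < y"
      proof (rule ccontr)
        assume "\<not> x < y"
        then have "y < x" using lt by (cases "x = y") auto
        moreover have "int r = pos R y - pos R x" using x y by linarith
        ultimately have "pos R x < lo R r" using window_leftward(2)[of y x m R r] x y lt by auto
        then show False using x assms by simp
      qed
      then show thesis using right x y lt by blast
    next
      case False
      have "lo R m \<le> k + int r - int m" "k + int r - int m < lo R m + int m"
        using False L assms by linarith+
      then obtain y where y: "1 \<le> y" "y \<le> m" "k + int r - int m = pos R y"
        using pos_onto by metis
      have "pos R y < pos R x" "k + int r = pos R y + int m" using x y assms by linarith+
      then show thesis using across x y by blast
    qed
  next
    case False
    have "lo R m \<le> k - int m" "k - int m < lo R m + int m"
      "lo R m \<le> k + int r - int m" "k + int r - int m < lo R m + int m"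
      using False L assms by linarith+
    then obtain x y where y: "1 \<le> y" "y \<le> m" "k - int m = pos R y"
      and x: "1 \<le> x" "x \<le> m" "k + int r - int m = pos R x"
      using pos_onto by metis
    have lt: "pos R y < pos R x" using x y assms by linarith
    have "x < y"
    proof (rule ccontr)
      assume "\<not> x < y"
      then have "y < x" using lt by (cases "x = y") auto
      then have "pos R x = lo R (x - 1) + int (x - 1)" "lo R (x - 1) \<le> pos R y"
        using lt y pos_outside[of y x R] pos_bounds[of y "x - 1" R] by auto
      moreover have "int r = pos R x - pos R y" using x y by linarith
      ultimately have "r \<le> x - 1" by linarith
      then show False
        using lo_plus_mono[of r "x - 1" R] \<open>pos R x = _\<close> x assms by linarith
    qed
    then show thesis using left[of x y] x y lt by auto
  qed
qed

section \<open>The orbits of the Coxeter element\<close>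

text \<open>
  The rank is \<open>n = Suc m\<close>: the two ends of the fork are the vertices \<open>m\<close> and \<open>Suc m\<close>, joined to
  \<open>m - 1\<close>, and \<open>m\<close> is both the length of the cycle of \<open>\<tau>\<close> up to sign and half the Coxeter
  number.
\<close>

locale type_D_quiver =
  fixes m :: nat and Q :: quiver and \<xi> :: "nat \<Rightarrow> int" and \<tau> :: "vec \<Rightarrow> vec"
  assumes m: "m \<ge> 3" and Q: "dynkin_quiver (Suc m) Q" and \<xi>: "height_function Q \<xi>"
    and cox: "adapted_coxeter (Suc m) Q \<tau>"
begin

text \<open>
  The last vector is always put at the right, whatever the orientation of the fork. This is no
  restriction because it appears negated at the place just left of the interval: the choice of
  \<open>last_sign\<close> below replaces the choice of a side.
\<close>

definition right :: "nat \<Rightarrow> bool" where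
  "right j \<longleftrightarrow> j = m \<or> (j - 1, j) \<in> Q"

abbreviation "low \<equiv> lo right"
abbreviation "slot \<equiv> pos right"

definition same_ends :: bool where
  "same_ends \<longleftrightarrow> ((m - 1, m) \<in> Q \<longleftrightarrow> (m - 1, Suc m) \<in> Q)"

text \<open>
  If the arrows at both ends of the fork have the same direction, then \<open>\<tau>\<close> negates
  \<open>\<epsilon>\<^sub>n\<close>, otherwise \<open>\<epsilon>\<^sub>n\<^sub>-\<^sub>1\<close>. The other one of these two vectors belongs to the cycle. The vectors
  \<open>E 1, \<dots>, E m\<close> below are the basis vectors on the cycle, with a sign for the last one, and
  \<open>F\<close> is the negated one.
\<close>

definition last_index :: nat where
  "last_index = (if same_ends then m else Suc m)"

definition fixed_index :: nat where
  "fixed_index = (if same_ends then Suc m else m)"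

definition last_sign :: real where
  "last_sign = (if (m - 1, Suc m) \<in> Q then 1 else -1)"

definition E :: "nat \<Rightarrow> vec" where
  "E j t = (if j = m then last_sign * eps last_index t else eps j t)"

definition F :: vec where
  "F = eps fixed_index"

definition antiperiodic :: "int \<Rightarrow> real" where
  "antiperiodic d = (if int m dvd d then if even (d div int m) then 1 else -1 else 0)"

text \<open>
  This is the family with \<open>v (slot j) = E j\<close> and \<open>v (q + m) = - v q\<close>, as the places of
  \<open>1, \<dots>, m\<close> represent all residues modulo \<open>m\<close>.
\<close>

definition v :: "int \<Rightarrow> vec" where
  "v q t = (\<Sum>j = 1..m. antiperiodic (q - slot j) * E j t)"

definition row :: "nat \<Rightarrow> nat" where
  "row i = min i m"

definition start :: "nat \<Rightarrow> int" where
  "start i = (if i < m then low i else if (m - 1, i) \<in> Q then low m else low m - 1)"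

definition end_sign :: "nat \<Rightarrow> real" where
  "end_sign i = (if i = m \<and> same_ends then -1 else 1)"

text \<open>
  The closed form of \<open>\<eta>\<close>: in the rows before the fork it spans the interval filled by the first
  \<open>i\<close> basis vectors, and at the fork it is the vector at the start of the row plus or minus \<open>F\<close>.
\<close>

definition e :: "nat \<Rightarrow> vec" where
  "e i t = (if i < m then v (start i) t - v (start i + int i) t
    else v (start i) t + end_sign i * F t)"

lemma edge_iff_m: "{i, j} \<in> dynkin_edges (Suc m) \<longleftrightarrow>
     (j = Suc i \<and> 1 \<le> i \<and> i < m) \<or> (i = Suc j \<and> 1 \<le> j \<and> j < m) \<or>
     (i = m - 1 \<and> j = Suc m) \<or> (i = Suc m \<and> j = m - 1)"
  using m unfolding edge_iff by auto

lemma arrow_edge: "(i, j) \<in> Q \<Longrightarrow> {i, j} \<in> dynkin_edges (Suc m)"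
  using Q unfolding dynkin_quiver_def by blast

lemma arrow_flip: "{i, j} \<in> dynkin_edges (Suc m) \<Longrightarrow> (j, i) \<in> Q \<longleftrightarrow> (i, j) \<notin> Q"
  using Q unfolding dynkin_quiver_def by blast

lemma low_m: "low m = low (m - 1)"
proof -
  have "right (Suc (m - 1))" using m by (simp add: right_def)
  then have "low (Suc (m - 1)) = low (m - 1)" by simp
  then show ?thesis using m by simp
qed

lemma slot_m: "slot m = low m + int m - 1"
  using m low_m by (simp add: pos_def right_def)

lemma antiperiodic_shift: "antiperiodic (d + z * int m) = (if even z then 1 else -1) * antiperiodic d"
  using m by (auto simp: antiperiodic_def dvd_add_left_iff)

lemma v_shift: "v (q + z * int m) t = (if even z then 1 else -1) * v q t"
proof -
  have "q + z * int m - slot j = (q - slot j) + z * int m" for j by simp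
  then show ?thesis by (simp only: v_def antiperiodic_shift sum_distrib_left mult.assoc)
qed

lemma v_plus_m [simp]: "v (q + int m) t = - v q t"
  using v_shift[of q 1 t] by simp

lemma antiperiodic_slot:
  assumes "1 \<le> i" "i \<le> m" "1 \<le> j" "j \<le> m"
  shows "antiperiodic (slot i - slot j) = (if i = j then 1 else 0)"
proof (cases "i = j")
  case False
  then have "slot i \<noteq> slot j" using assms pos_eq_iff by blast
  moreover have "\<bar>slot i - slot j\<bar> < int m"
    using pos_bounds[of i m right] pos_bounds[of j m right] assms by linarith
  ultimately have "\<not> int m dvd slot i - slot j"
    using zdvd_not_zless by (metis abs_dvd_iff abs_of_nat dvd_abs_iff eq_iff_diff_eq_0 zero_less_abs_iff)
  then show ?thesis using False by (simp add: antiperiodic_def)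
qed (simp add: antiperiodic_def)

lemma v_slot [simp]:
  assumes "1 \<le> i" "i \<le> m"
  shows "v (slot i) t = E i t"
proof -
  have "v (slot i) t = (\<Sum>j = 1..m. if j = i then E j t else 0)"
    unfolding v_def using assms by (intro sum.cong) (auto simp: antiperiodic_slot)
  then show ?thesis using assms by simp
qed

lemma v_cases:
  obtains j c where "1 \<le> j" "j \<le> m" "c = 1 \<or> c = -1" "\<And>d t. v (q + d) t = c * v (slot j + d) t"
proof -
  define z where "z = (q - low m) div int m"
  have "low m \<le> low m + (q - low m) mod int m" "low m + (q - low m) mod int m < low m + int m"
    using m by auto
  then obtain j where j: "1 \<le> j" "j \<le> m" "low m + (q - low m) mod int m = slot j"
    using pos_onto by metis
  have "q = slot j + z * int m"
    using j(3) div_mult_mod_eq[of "q - low m" "int m"] unfolding z_def by linarith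
  then have "v (q + d) t = (if even z then 1 else -1) * v (slot j + d) t" for d t
    using v_shift[of "slot j + d" z t] by (simp add: algebra_simps)
  then show thesis using that[of j "if even z then 1 else -1"] j by auto
qed

text \<open>
  Passing from \<open>i - 1\<close> to \<open>i\<close> moves one end of the interval by one, and \<open>E i\<close> sits at that end.
  The first equation serves the recursion for \<open>e\<close>. The second one contains the action of \<open>\<tau>\<close>,
  since \<open>\<tau> (\<epsilon>\<^sub>i) = \<epsilon>\<^sub>i - (e i - e (i - 1))\<close>.
\<close>

lemma e_step:
  assumes "1 \<le> i" "i < m"
  shows "e i t - (if (i - 1, i) \<in> Q then e (i - 1) t else 0) = E i t - v (low i + int i) t"
    and "e i t - e (i - 1) t = E i t - v (slot i + 1) t"
proof -
  obtain k where k: "i = Suc k" using assms by (cases i) auto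
  have v: "v (slot i) t = E i t" using assms by simp
  have R: "right i \<longleftrightarrow> (k, i) \<in> Q" using k assms by (simp add: right_def)
  show "e i t - (if (i - 1, i) \<in> Q then e (i - 1) t else 0) = E i t - v (low i + int i) t"
    and "e i t - e (i - 1) t = E i t - v (slot i + 1) t"
    using assms v R unfolding k by (auto simp: e_def start_def pos_def algebra_simps)
qed

lemma e_fork:
  "e (m - Suc 0) t = v (low m) t - E m t"
  "i \<ge> m \<Longrightarrow> e i t = (if (m - Suc 0, i) \<in> Q then v (low m) t else - E m t) + end_sign i * F t"
proof -
  have "v (slot m) t = E m t" using m by simp
  then have "v (low m + int m - 1) t = E m t" by (simp add: slot_m)
  moreover have "v (low m - 1 + int m) t = - v (low m - 1) t" by simp
  ultimately show "e (m - Suc 0) t = v (low m) t - E m t"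
    "i \<ge> m \<Longrightarrow> e i t = (if (m - Suc 0, i) \<in> Q then v (low m) t else - E m t) + end_sign i * F t"
    using m low_m by (auto simp: e_def start_def of_nat_diff algebra_simps)
qed

lemma sum_predecessors:
  fixes f :: "nat \<Rightarrow> real"
  assumes "\<And>j. (j, i) \<in> Q \<Longrightarrow> j \<in> N" "finite N"
  shows "(\<Sum>j | (j, i) \<in> Q. f j) = (\<Sum>j\<in>N. if (j, i) \<in> Q then f j else 0)"
proof -
  have "{j. (j, i) \<in> Q} = {j \<in> N. (j, i) \<in> Q}" using assms by auto
  then show ?thesis using assms(2) by (simp add: sum.inter_filter)
qed

lemma fork_arrows:
  "(m, m - Suc 0) \<in> Q \<longleftrightarrow> (m - Suc 0, m) \<notin> Q"
  "(Suc m, m - Suc 0) \<in> Q \<longleftrightarrow> (m - Suc 0, Suc m) \<notin> Q"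
  using m by (auto intro!: arrow_flip simp: edge_iff_m)

text \<open>
  Only two or three neighbours contribute. The predecessor \<open>i - 1\<close>, if there is one, is covered by
  \<open>e_step\<close>, which leaves the vector just beyond the right end. It is \<open>E (i + 1)\<close> if
  \<open>i \<rightarrow> i + 1\<close>, and otherwise the predecessor \<open>i + 1\<close> turns it into \<open>E (i + 1)\<close>. At the fork, the
  four possible orientations are checked one by one.
\<close>

lemma e_recursion:
  assumes i: "i \<in> {1..Suc m}"
  shows "e i t = simple_root (Suc m) i t + (\<Sum>j | (j, i) \<in> Q. e j t)"
proof -
  consider "1 \<le> i" "Suc i < m" | "Suc i = m" | "i = m" | "i = Suc m" using i by force
  then show ?thesis
  proof cases
    case 1
    have "(\<Sum>j | (j, i) \<in> Q. e j t) = (\<Sum>j\<in>{i - 1, Suc i}. if (j, i) \<in> Q then e j t else 0)"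
      by (rule sum_predecessors) (use 1 in \<open>auto dest!: arrow_edge simp: edge_iff_m\<close>)
    then have sum: "(\<Sum>j | (j, i) \<in> Q. e j t) = (if (i - 1, i) \<in> Q then e (i - 1) t else 0) +
        (if (Suc i, i) \<in> Q then e (Suc i) t else 0)" by simp
    have flip: "(Suc i, i) \<in> Q \<longleftrightarrow> (i, Suc i) \<notin> Q" using 1 by (intro arrow_flip) (simp add: edge_iff_m)
    have "v (slot (Suc i)) t = E (Suc i) t" using 1 by (intro v_slot) auto
    then have "v (low i + int i) t + (if (Suc i, i) \<in> Q then e (Suc i) t else 0) = E (Suc i) t"
      using 1 flip by (auto simp: pos_def right_def e_def start_def algebra_simps)
    moreover have "simple_root (Suc m) i t = E i t - E (Suc i) t"
      using 1 by (simp add: simple_root_def E_def)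
    ultimately show ?thesis using e_step(1)[of i t] sum 1 by auto
  next
    case 2
    then have i': "i = m - 1" "1 \<le> i" using m by auto
    have sum_eq: "(\<Sum>j | (j, i) \<in> Q. e j t) = (\<Sum>j\<in>{i - 1, m, Suc m}. if (j, i) \<in> Q then e j t else 0)"
    proof (rule sum_predecessors)
      fix j assume "(j, i) \<in> Q"
      then show "j \<in> {i - 1, m, Suc m}" using arrow_edge[of j i] 2 unfolding edge_iff_m by auto
    qed simp
    have sum: "(\<Sum>j | (j, i) \<in> Q. e j t) = (if (i - 1, i) \<in> Q then e (i - 1) t else 0) +
        ((if (m, m - 1) \<in> Q then e m t else 0) + (if (Suc m, m - 1) \<in> Q then e (Suc m) t else 0))"
    proof -
      have "i - 1 \<noteq> m" "i - 1 \<noteq> Suc m" using 2 by auto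
      then show ?thesis unfolding sum_eq using i'(1) by simp
    qed
    have "v (slot m) t = E m t" using m by simp
    then have "v (low i + int i) t = E m t"
      using i' m low_m by (simp add: slot_m of_nat_diff algebra_simps)
    moreover have "simple_root (Suc m) i t = E i t - eps m t"
      using 2 by (simp add: simple_root_def E_def)
    moreover have "E m t + ((if (m, m - 1) \<in> Q then e m t else 0) +
        (if (Suc m, m - 1) \<in> Q then e (Suc m) t else 0)) = eps m t"
      by (auto simp: fork_arrows e_fork E_def F_def end_sign_def same_ends_def
          last_index_def fixed_index_def last_sign_def)
    ultimately show ?thesis using e_step(1)[of i t] sum 2 i' by linarith
  next
    case 3
    have "(\<Sum>j | (j, i) \<in> Q. e j t) = (\<Sum>j\<in>{m - 1}. if (j, i) \<in> Q then e j t else 0)"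
      by (rule sum_predecessors) (use 3 m in \<open>auto dest!: arrow_edge simp: edge_iff_m\<close>)
    then show ?thesis using 3 m
      by (auto simp: fork_arrows e_fork E_def F_def end_sign_def same_ends_def
          last_index_def fixed_index_def last_sign_def simple_root_def)
  next
    case 4
    have "(\<Sum>j | (j, i) \<in> Q. e j t) = (\<Sum>j\<in>{m - 1}. if (j, i) \<in> Q then e j t else 0)"
      by (rule sum_predecessors) (use 4 m in \<open>auto dest!: arrow_edge simp: edge_iff_m\<close>)
    then show ?thesis using 4 m
      by (auto simp: fork_arrows e_fork E_def F_def end_sign_def same_ends_def
          last_index_def fixed_index_def last_sign_def simple_root_def)
  qed
qed

lemma eta_eq: "i \<in> {1..Suc m} \<Longrightarrow> eta (Suc m) Q i = e i"
  using m e_recursion by (intro eta_unique[OF _ Q \<xi>]) auto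

lemma \<tau>_apply: "\<tau> x t = x t - (\<Sum>i = 1..Suc m. ip (Suc m) x (simple_root (Suc m) i) * e i t)"
  using m e_recursion by (intro coxeter_element_apply[OF _ Q cox]) auto

lemma \<tau>_add: "\<tau> (\<lambda>t. x t + c * y t) t = \<tau> x t + c * \<tau> y t"
  unfolding \<tau>_apply by (simp add: ip_def algebra_simps sum.distrib sum_distrib_left)

lemma \<tau>_scale: "\<tau> (\<lambda>t. c * y t) t = c * \<tau> y t"
  unfolding \<tau>_apply by (simp add: ip_def algebra_simps sum_distrib_left)

lemma \<tau>_eps:
  assumes "1 \<le> j" "j < m"
  shows "\<tau> (eps j) t = eps j t - (e j t - e (j - 1) t)"
proof -
  have "(\<Sum>i = 1..Suc m. ip (Suc m) (eps j) (simple_root (Suc m) i) * e i t)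
      = (\<Sum>i = 1..Suc m. (if i = j then e i t else 0) - (if Suc i = j then e i t else 0))"
    using assms by (intro sum.cong) (auto simp: ip_simple_root eps_def)
  also have "\<dots> = e j t - (\<Sum>i = 1..Suc m. if Suc i = j then e i t else 0)"
    using assms by (simp add: sum_subtractf)
  also have "(\<Sum>i = 1..Suc m. if Suc i = j then e i t else 0)
      = (\<Sum>i = 1..Suc m. if i = j - 1 then e i t else 0)"
    using assms by (intro sum.cong) auto
  also have "\<dots> = e (j - 1) t"
    using assms by (cases "j = 1") (auto simp: e_def start_def)
  finally show ?thesis by (simp add: \<tau>_apply)
qed

lemma \<tau>_eps_fork:
  "\<tau> (eps m) t = eps m t - (e m t + e (Suc m) t - e (m - 1) t)"
  "\<tau> (eps (Suc m)) t = eps (Suc m) t - (e (Suc m) t - e m t)"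
proof -
  have split: "(\<Sum>i = 1..Suc m. f i) = (\<Sum>i = 1..m - 2. f i) + f (m - 1) + f m + f (Suc m)"
    for f :: "nat \<Rightarrow> real"
  proof -
    obtain k where "m = Suc (Suc (Suc k))" using m by (metis Suc_diff_le add_2_eq_Suc diff_Suc_Suc le_add_diff_inverse numeral_3_eq_3 plus_1_eq_Suc add_Suc)
    then show ?thesis by simp
  qed
  have "(\<Sum>i = 1..m - 2. ip (Suc m) (eps j) (simple_root (Suc m) i) * e i t) = 0"
    if "j \<ge> m" for j
  proof (intro sum.neutral ballI)
    fix i assume "i \<in> {1..m - 2}"
    then have "1 \<le> i" "Suc i < m" using m by auto
    then show "ip (Suc m) (eps j) (simple_root (Suc m) i) * e i t = 0"
      using that by (simp add: ip_simple_root eps_def)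
  qed
  from this[of m] this[of "Suc m"]
  have "(\<Sum>i = 1..m - 2. ip (Suc m) (eps m) (simple_root (Suc m) i) * e i t) = 0"
    "(\<Sum>i = 1..m - 2. ip (Suc m) (eps (Suc m)) (simple_root (Suc m) i) * e i t) = 0" by auto
  moreover have "ip (Suc m) x (simple_root (Suc m) (m - Suc 0)) = x (m - Suc 0) - x m" for x
  proof -
    obtain j where j: "m = Suc j" "j \<ge> 1" using m by (cases m) auto
    then show ?thesis using ip_simple_root[of "Suc m" j x] by simp
  qed
  ultimately show "\<tau> (eps m) t = eps m t - (e m t + e (Suc m) t - e (m - 1) t)"
    "\<tau> (eps (Suc m)) t = eps (Suc m) t - (e (Suc m) t - e m t)"
    using m unfolding \<tau>_apply split by (auto simp: ip_simple_root eps_def)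
qed

lemma \<tau>_F: "\<tau> F t = - F t"
  unfolding F_def fixed_index_def
  by (auto simp: \<tau>_eps_fork fork_arrows e_fork E_def F_def end_sign_def same_ends_def
          last_index_def fixed_index_def last_sign_def)

lemma \<tau>_E:
  assumes "1 \<le> j" "j \<le> m"
  shows "\<tau> (E j) t = v (slot j + 1) t"
proof (cases "j = m")
  case True
  have "E m = (\<lambda>t. last_sign * eps last_index t)" by (simp add: fun_eq_iff E_def)
  then have "\<tau> (E m) t = last_sign * \<tau> (eps last_index) t" by (simp add: \<tau>_scale)
  also have "\<dots> = - v (low m) t"
    by (auto simp: \<tau>_eps_fork fork_arrows e_fork E_def F_def end_sign_def same_ends_def
          last_index_def fixed_index_def last_sign_def)
  finally show ?thesis using True by (simp add: slot_m)
next
  case False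
  then have "E j = eps j" by (simp add: fun_eq_iff E_def)
  then show ?thesis using \<tau>_eps[of j t] e_step(2)[of j t] assms False by (simp add: E_def)
qed

lemma \<tau>_v: "\<tau> (v q) t = v (q + 1) t"
proof -
  obtain j c where j: "1 \<le> j" "j \<le> m" and v: "\<And>d t. v (q + d) t = c * v (slot j + d) t"
    using v_cases by metis
  have "v q = (\<lambda>t. c * E j t)" using v[of 0] j by (simp add: fun_eq_iff)
  then show ?thesis using v[of 1] j by (simp add: \<tau>_scale \<tau>_E)
qed

lemma \<tau>_power_e:
  assumes "i \<in> {1..Suc m}"
  shows "(\<tau> ^^ k) (eta (Suc m) Q i) t =
    (if i < m then v (start i + int k) t - v (start i + int k + int i) t
     else v (start i + int k) t + end_sign i * (-1) ^ k * F t)"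
proof (induction k arbitrary: t)
  case 0
  then show ?case by (simp add: eta_eq[OF assms] e_def)
next
  case (Suc k)
  show ?case
  proof (cases "i < m")
    case True
    then have "(\<tau> ^^ k) (eta (Suc m) Q i) =
        (\<lambda>t. v (start i + int k) t + (-1) * v (start i + int k + int i) t)"
      using Suc by (simp add: fun_eq_iff)
    then have "(\<tau> ^^ Suc k) (eta (Suc m) Q i) t = v (start i + int k + 1) t
        + (-1) * v (start i + int k + int i + 1) t"
      by (simp only: funpow.simps comp_apply \<tau>_add \<tau>_v)
    then show ?thesis using True by (simp add: algebra_simps)
  next
    case False
    then have "(\<tau> ^^ k) (eta (Suc m) Q i) =
        (\<lambda>t. v (start i + int k) t + (end_sign i * (-1) ^ k) * F t)"
      using Suc by (simp add: fun_eq_iff)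
    then have "(\<tau> ^^ Suc k) (eta (Suc m) Q i) t = v (start i + int k + 1) t
        + (end_sign i * (-1) ^ k) * - F t"
      by (simp only: funpow.simps comp_apply \<tau>_add \<tau>_v \<tau>_F)
    then show ?thesis using False by (simp add: algebra_simps)
  qed
qed

end

section \<open>Coordinates of roots\<close>

lemma uminus_pos_root:
  assumes "\<alpha> \<in> pos_roots n" "\<beta> \<in> pos_roots n"
  shows "\<alpha> \<noteq> - \<beta>"
proof
  assume eq: "\<alpha> = - \<beta>"
  obtain a b p where a: "a < b" "p = 1 \<or> p = -1" "\<And>t. \<alpha> t = eps a t + p * eps b t"
    using assms(1) by (fastforce simp: pos_roots_def)
  obtain c d q where c: "c < d" "q = 1 \<or> q = -1" "\<And>t. \<beta> t = eps c t + q * eps d t"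
    using assms(2) by (fastforce simp: pos_roots_def)
  have H: "eps a t + p * eps b t = - (eps c t + q * eps d t)" for t
    using eq a(3)[of t] c(3)[of t] by simp
  show False using H[of a] H[of c] a(1,2) c(1,2) by (auto simp: eps_def split: if_splits)
qed

lemma pos_roots_plus: "1 \<le> a \<Longrightarrow> a < b \<Longrightarrow> b \<le> n \<Longrightarrow> eps a + eps b \<in> pos_roots n"
  and pos_roots_minus: "1 \<le> a \<Longrightarrow> a < b \<Longrightarrow> b \<le> n \<Longrightarrow> eps a - eps b \<in> pos_roots n"
  by (auto simp: pos_roots_def)

lemma ar_length_bounds:
  assumes pos: "\<And>l. l \<le> k \<Longrightarrow> (\<tau> ^^ l) (eta n Q i) \<in> pos_roots n"
    and neg: "(\<tau> ^^ N) (eta n Q i) \<notin> pos_roots n"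
  shows "k \<le> ar_length n Q \<tau> i" "ar_length n Q \<tau> i < N"
proof -
  define S where "S = {k. \<forall>l \<le> k. (\<tau> ^^ l) (eta n Q i) \<in> pos_roots n}"
  have "S \<subseteq> {..<N}" 
  proof
    fix j assume "j \<in> S"
    then have "\<not> N \<le> j" using neg by (auto simp: S_def)
    then show "j \<in> {..<N}" by simp
  qed
  then have "finite S" by (rule finite_subset) simp
  moreover have "k \<in> S" using pos by (simp add: S_def)
  ultimately have "k \<le> Max S" "Max S \<in> S" by (auto intro: Max_in)
  then show "k \<le> ar_length n Q \<tau> i" "ar_length n Q \<tau> i < N"
    using \<open>S \<subseteq> {..<N}\<close> unfolding ar_length_def S_def[symmetric] by auto
qed

context type_D_quiver
begin

abbreviation "V \<equiv> ar_vertices (Suc m) Q \<xi> \<tau>"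
abbreviation "arrows \<equiv> ar_arrows (Suc m) Q \<xi> \<tau>"
abbreviation "vertex_root \<equiv> ar_root (Suc m) Q \<xi> \<tau>"
abbreviation "len \<equiv> ar_length (Suc m) Q \<tau>"
abbreviation "\<Phi> \<equiv> pos_roots (Suc m)"

lemma E_minus_pos: "1 \<le> x \<Longrightarrow> x < y \<Longrightarrow> y \<le> m \<Longrightarrow> E x - E y \<in> \<Phi>"
proof -
  assume x: "1 \<le> x" "x < y" "y \<le> m"
  then have "E x - E y = eps x - eps y \<and> y \<noteq> m \<or> E x - E y = eps x - eps last_index \<or>
      E x - E y = eps x + eps last_index"
    by (cases "y = m") (auto simp: fun_eq_iff E_def last_sign_def)
  then show ?thesis using x by (auto simp: last_index_def intro!: pos_roots_plus pos_roots_minus)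
qed

lemma E_plus_pos:
  assumes "1 \<le> x" "x \<le> m" "1 \<le> y" "y \<le> m" "x \<noteq> y"
  shows "E x + E y \<in> \<Phi>"
proof -
  have less: "E x + E y \<in> \<Phi>" if x: "1 \<le> x" "x < y" "y \<le> m" for x y
  proof -
    have "E x + E y = eps x + eps y \<and> y \<noteq> m \<or> E x + E y = eps x - eps last_index \<or>
        E x + E y = eps x + eps last_index"
      using x by (cases "y = m") (auto simp: fun_eq_iff E_def last_sign_def)
    then show ?thesis using x by (auto simp: last_index_def intro!: pos_roots_plus pos_roots_minus)
  qed
  show ?thesis using less[of x y] less[of y x] assms by (cases "x < y") (auto simp: add.commute)
qed

lemma E_F_pos:
  assumes "1 \<le> x" "x < m" "c = 1 \<or> c = -1"
  shows "(\<lambda>t. E x t + c * F t) \<in> \<Phi>"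
proof -
  have "(\<lambda>t. E x t + c * F t) = eps x + eps fixed_index \<or>
      (\<lambda>t. E x t + c * F t) = eps x - eps fixed_index"
    using assms by (auto simp: fun_eq_iff E_def F_def)
  then show ?thesis
    using assms by (auto simp: fixed_index_def intro!: pos_roots_plus pos_roots_minus)
qed

lemma v_below: "v (low m - 1) t = - E m t"
proof -
  have "v (low m - 1 + int m) t = E m t" using v_slot[of m t] m by (simp add: slot_m algebra_simps)
  then show ?thesis by simp
qed

text \<open>
  The coordinates of a root. The first three rules follow the three positions of a window relative
  to the interval filled by all \<open>m\<close> vectors. In the last rule the lower bound is
  \<open>low m - 1\<close>, because the row of an end of the fork that points towards \<open>m - 1\<close> starts one
  place before the interval.
\<close>

inductive located :: "vec \<Rightarrow> int \<Rightarrow> int \<Rightarrow> bool" where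
  right: "located (E x - E y) (slot x) (slot y)"
    if "1 \<le> x" "x < y" "y \<le> m" "slot x < slot y"
| left: "located (E x - E y) (slot y + int m) (slot x + int m)"
    if "1 \<le> x" "x < y" "y \<le> m" "slot y < slot x"
| across: "located (E x + E y) (slot x) (slot y + int m)"
    if "1 \<le> x" "x \<le> m" "1 \<le> y" "y \<le> m" "slot y < slot x"
| fork: "located (\<lambda>t. v k t + c * F t) k (k + int m)"
    if "c = 1 \<or> c = -1" "low m - 1 \<le> k" "k < low m + int m"

text \<open>
  The region of the coordinates in the rows before the fork: row \<open>r\<close> starts at \<open>low r\<close> and has
  \<open>m\<close> vertices.
\<close>

definition inner :: "int \<Rightarrow> int \<Rightarrow> bool" where
  "inner k l \<longleftrightarrow> k < l \<and> l < k + int m \<and> low (nat (l - k)) \<le> k \<and> k < low (nat (l - k)) + int m"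

lemma inner_imp_located:
  assumes "inner k l"
  shows "located (v k - v l) k l" "v k - v l \<in> \<Phi>"
proof -
  define r where "r = nat (l - k)"
  have r: "1 \<le> r" "r < m" "low r \<le> k" "k < low r + int m" and l: "l = k + int r"
    using assms unfolding inner_def r_def by auto
  have "located (v k - v l) k l \<and> v k - v l \<in> \<Phi>"
    using r
  proof (cases rule: window_cases)
    case (right x y)
    then have "v k - v l = E x - E y" by (simp add: fun_eq_iff l)
    then show ?thesis using right located.right[of x y] E_minus_pos[of x y] l by simp
  next
    case (across x y)
    then have "v k - v l = E x + E y" by (simp add: fun_eq_iff l)
    then show ?thesis using across located.across[of x y] E_plus_pos[of x y] l by auto
  next
    case (left x y)
    then have "l = slot x + int m" by (simp add: l)
    moreover from this left have "v k - v l = E x - E y" by (simp add: fun_eq_iff)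
    ultimately show ?thesis using left(1-5) located.left[of x y] E_minus_pos[of x y] by simp
  qed
  then show "located (v k - v l) k l" "v k - v l \<in> \<Phi>" by auto
qed

lemma located_imp_inner:
  assumes "located \<alpha> k l" "l < k + int m"
  shows "inner k l" "\<alpha> = v k - v l"
proof -
  from assms have "inner k l \<and> \<alpha> = v k - v l"
  proof cases
    case (right x y)
    then show ?thesis
      using window_rightward[of x y m right "nat (l - k)"] by (auto simp: inner_def fun_eq_iff)
  next
    case (left x y)
    then show ?thesis
      using window_leftward[of x y m right "nat (l - k)"] by (auto simp: inner_def fun_eq_iff)
  next
    case (across x y)
    moreover have "slot x < slot y + int m"
      using across pos_bounds[of x m right] pos_bounds[of y m right] by auto
    ultimately show ?thesis
      using window_across[of x m y right "nat (l - k)"] by (auto simp: inner_def fun_eq_iff)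
  qed auto
  then show "inner k l" "\<alpha> = v k - v l" by auto
qed

text \<open>
  The coordinates with respect to \<open>E\<close>; the sign of \<open>E m\<close> is its own inverse.
\<close>

definition coef :: "nat \<Rightarrow> vec \<Rightarrow> real" where
  "coef j \<alpha> = (if j = m then last_sign * \<alpha> last_index else \<alpha> j)"

lemma coef_E: "1 \<le> x \<Longrightarrow> x \<le> m \<Longrightarrow> 1 \<le> j \<Longrightarrow> j \<le> m \<Longrightarrow> coef j (E x) = (if x = j then 1 else 0)"
  by (auto simp: coef_def E_def eps_def last_sign_def last_index_def)

lemma coef_linear:
  "coef j (\<alpha> + \<beta>) = coef j \<alpha> + coef j \<beta>" "coef j (\<alpha> - \<beta>) = coef j \<alpha> - coef j \<beta>"
  "coef j (- \<alpha>) = - coef j \<alpha>"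
  by (auto simp: coef_def algebra_simps)

lemma coef_F: "j \<le> m \<Longrightarrow> coef j (\<lambda>t. \<alpha> t + c * F t) = coef j \<alpha>"
  by (auto simp: coef_def F_def eps_def last_index_def fixed_index_def)

lemma E_fixed_index: "x \<le> m \<Longrightarrow> E x fixed_index = 0"
  by (auto simp: E_def eps_def fixed_index_def last_index_def)

lemma v_fixed_index: "v k fixed_index = 0"
  unfolding v_def by (intro sum.neutral) (auto simp: E_fixed_index)

lemma F_fixed_index: "F fixed_index = 1"
  by (simp add: F_def eps_def)

lemma located_fixed_index:
  assumes "located \<alpha> k l"
  shows "\<alpha> fixed_index = 0 \<longleftrightarrow> l \<noteq> k + int m"
  using assms
proof cases
  case (right x y)
  then show ?thesis
    using pos_bounds[of x m right] pos_bounds[of y m right] by (auto simp: E_fixed_index)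
next
  case (left x y)
  then show ?thesis
    using pos_bounds[of x m right] pos_bounds[of y m right] by (auto simp: E_fixed_index)
next
  case (across x y)
  then show ?thesis
    using pos_bounds[of x m right] pos_bounds[of y m right] by (auto simp: E_fixed_index)
next
  case (fork c)
  then show ?thesis by (auto simp: v_fixed_index F_fixed_index)
qed

lemma fork_cases:
  assumes "low m - 1 \<le> k" "k < low m + int m"
  obtains "k = low m - 1" "v k = - E m" | x where "1 \<le> x" "x \<le> m" "k = slot x" "v k = E x"
proof (cases "k = low m - 1")
  case True
  then show thesis using that(1) v_below by (simp add: fun_eq_iff)
next
  case False
  then have "low m \<le> k" using assms by simp
  then obtain x where "1 \<le> x" "x \<le> m" "k = slot x" using pos_onto assms by metis
  then show thesis using that(2) by (simp add: fun_eq_iff)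
qed

lemma fork_unique:
  assumes "low m - 1 \<le> k" "k < low m + int m" "low m - 1 \<le> k'" "k' < low m + int m"
    and eq: "\<And>j. 1 \<le> j \<Longrightarrow> j \<le> m \<Longrightarrow> coef j (v k) = coef j (v k')"
  shows "k = k'"
proof (rule fork_cases[OF assms(1,2)]; rule fork_cases[OF assms(3,4)])
  fix x assume "k = low m - 1" "v k = - E m" "1 \<le> x" "x \<le> m" "v k' = E x"
  then show ?thesis using eq[of x] m by (auto simp: coef_E coef_linear split: if_splits)
next
  fix x assume "k' = low m - 1" "v k' = - E m" "1 \<le> x" "x \<le> m" "v k = E x"
  then show ?thesis using eq[of x] m by (auto simp: coef_E coef_linear split: if_splits)
next
  fix x y assume "1 \<le> x" "x \<le> m" "k = slot x" "v k = E x" "1 \<le> y" "y \<le> m" "k' = slot y" "v k' = E y"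
  then show ?thesis using eq[of x] by (auto simp: coef_E split: if_splits)
qed simp

text \<open>
  A root determines its two summands in the basis \<open>E, F\<close>, and the rules for the coordinates use
  nothing else; in the last rule the place \<open>k\<close> is found from \<open>v k\<close>, as only \<open>m + 1\<close> consecutive
  places are allowed, and the two extreme ones carry opposite vectors.
\<close>

lemma located_unique:
  assumes "located \<alpha> k l" "located \<alpha> k' l'"
  shows "k = k'" "l = l'"
proof -
  have minus: "x = x' \<and> y = y'" if "E x - E y = E x' - E y'" "1 \<le> x" "x < y" "y \<le> m"
    "1 \<le> x'" "x' < y'" "y' \<le> m" for x y x' y'
    using arg_cong[OF that(1), of "coef x"] arg_cong[OF that(1), of "coef y"] that(2-)
    by (auto simp: coef_linear coef_E split: if_splits)
  have mixed: "E x - E y \<noteq> E x' + E y'" if "1 \<le> x" "x < y" "y \<le> m"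
    "1 \<le> x'" "x' \<le> m" "1 \<le> y'" "y' \<le> m" for x y x' y'
    using that by (auto dest!: arg_cong[where f = "coef y"] simp: coef_linear coef_E split: if_splits)
  have plus: "x = x' \<and> y = y'" if "E x + E y = E x' + E y'" "1 \<le> x" "x \<le> m" "1 \<le> y" "y \<le> m"
    "1 \<le> x'" "x' \<le> m" "1 \<le> y'" "y' \<le> m" "slot y < slot x" "slot y' < slot x'" for x y x' y'
    using arg_cong[OF that(1), of "coef x"] arg_cong[OF that(1), of "coef y"] that(2-)
    by (auto simp: coef_linear coef_E split: if_splits)
  have "l = k + int m \<longleftrightarrow> l' = k' + int m"
    using located_fixed_index[OF assms(1)] located_fixed_index[OF assms(2)] by blast
  moreover have "k = k' \<and> l = l'" if "l = k + int m" "l' = k' + int m"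
  proof -
    have fork: "\<exists>c. low m - 1 \<le> k \<and> k < low m + int m \<and> \<alpha> = (\<lambda>t. v k t + c * F t)"
      if "located \<alpha> k (k + int m)" for k
      using that
    proof cases
      case (right x y)
      then show ?thesis using pos_bounds[of x m right] pos_bounds[of y m right] by auto
    next
      case (left x y)
      then show ?thesis using pos_bounds[of x m right] pos_bounds[of y m right] by auto
    qed auto
    obtain c where k: "low m - 1 \<le> k" "k < low m + int m" "\<alpha> = (\<lambda>t. v k t + c * F t)"
      using fork assms(1) \<open>l = k + int m\<close> by blast
    obtain c' where k': "low m - 1 \<le> k'" "k' < low m + int m" "\<alpha> = (\<lambda>t. v k' t + c' * F t)"
      using fork assms(2) \<open>l' = k' + int m\<close> by blast
    have "coef j (v k) = coef j (v k')" if "j \<le> m" for j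
      using that coef_F[of j "v k" c] coef_F[of j "v k'" c'] k(3) k'(3) by simp
    then show ?thesis using fork_unique k k' that by metis
  qed
  moreover have "k = k' \<and> l = l'" if "l \<noteq> k + int m" "l' \<noteq> k' + int m"
    using assms(1)
  proof cases
    case (right x y)
    from assms(2) show ?thesis
      using that right by cases (use minus mixed in \<open>metis | fastforce\<close>)+
  next
    case (left x y)
    from assms(2) show ?thesis
      using that left by cases (use minus mixed in \<open>metis | fastforce\<close>)+
  next
    case (across x y)
    from assms(2) show ?thesis
      using that across by cases (use plus mixed in \<open>metis | fastforce\<close>)+
  qed (use that in auto)
  ultimately show "k = k'" "l = l'" by blast+
qed


lemma \<tau>_power_inner:
  assumes "1 \<le> i" "i < m"
  shows "(\<tau> ^^ k) (eta (Suc m) Q i) = v (low i + int k) - v (low i + int k + int i)"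
  using assms by (simp add: fun_eq_iff \<tau>_power_e start_def)

lemma \<tau>_power_fork:
  assumes "i = m \<or> i = Suc m"
  shows "(\<tau> ^^ k) (eta (Suc m) Q i) =
    (\<lambda>t. v (start i + int k) t + end_sign i * (-1) ^ k * F t)"
  using assms m by (auto simp: fun_eq_iff \<tau>_power_e)

text \<open>
  Since \<open>\<tau>\<close> shifts the window, positivity lasts for \<open>m\<close> steps, after which
  \<open>\<tau> ^^ m\<close> has turned \<open>\<eta>\<close> into its negative.
\<close>

lemma len_inner:
  assumes "1 \<le> i" "i < m"
  shows "len i = m - 1"
proof -
  have pos: "(\<tau> ^^ l) (eta (Suc m) Q i) \<in> \<Phi>" if "l \<le> m - 1" for l
    unfolding \<tau>_power_inner[OF assms] using that assms by (intro inner_imp_located) (auto simp: inner_def)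
  have "(\<tau> ^^ m) (eta (Suc m) Q i) = - (\<tau> ^^ 0) (eta (Suc m) Q i)"
  proof
    fix t
    show "(\<tau> ^^ m) (eta (Suc m) Q i) t = (- (\<tau> ^^ 0) (eta (Suc m) Q i)) t"
      unfolding \<tau>_power_inner[OF assms]
      using v_plus_m[of "low i" t] v_plus_m[of "low i + int i" t] by (simp add: algebra_simps)
  qed
  then have neg: "(\<tau> ^^ m) (eta (Suc m) Q i) \<notin> \<Phi>" using uminus_pos_root pos[of 0] by (metis le0)
  have "m - 1 \<le> len i" "len i < m"
    using ar_length_bounds[of "m - 1", OF pos neg] by auto
  then show ?thesis by simp
qed

lemma start_fork: "i \<ge> m \<Longrightarrow> start i = low m \<or> start i = low m - 1"
  by (simp add: start_def)

lemma end_sign_power: "end_sign i * (-1) ^ k = 1 \<or> end_sign i * (-1) ^ k = -1"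
  by (cases "even k") (auto simp: end_sign_def)

text \<open>
  The sign of a root \<open>v k \<plusminus> F\<close> is that of \<open>v k\<close>, unless \<open>v k\<close> is \<open>E m\<close> up to sign. In that
  case the answer depends on the orientation and on the parity of \<open>m\<close>, so the length of the row
  is only determined up to one. The exceptional roots are not part of any pair considered here.
\<close>

lemma len_fork:
  assumes i: "i = m \<or> i = Suc m"
  shows "start i + int (len i) < low m + int m"
    and "start i + int k \<le> low m + int m - 2 \<Longrightarrow> k \<le> len i"
proof -
  have first: "(\<lambda>t. - E m t + end_sign i * F t) \<in> \<Phi>" if "(m - 1, i) \<notin> Q"
  proof -
    have "(\<lambda>t. - E m t + end_sign i * F t) = eps m - eps (Suc m) \<or>
        (\<lambda>t. - E m t + end_sign i * F t) = eps m + eps (Suc m)"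
      using that i by (auto simp: fun_eq_iff E_def F_def end_sign_def same_ends_def
          last_index_def fixed_index_def last_sign_def)
    then show ?thesis using m by (auto intro!: pos_roots_plus pos_roots_minus)
  qed
  have pos: "(\<tau> ^^ k) (eta (Suc m) Q i) \<in> \<Phi>" if k: "start i + int k \<le> low m + int m - 2" for k
  proof (cases "start i + int k = low m - 1")
    case True
    then have "k = 0" "(m - 1, i) \<notin> Q" using i by (auto simp: start_def split: if_splits)
    then show ?thesis using first True unfolding \<tau>_power_fork[OF i] by (simp add: v_below)
  next
    case False
    have "low m - 1 \<le> start i + int k" "start i + int k < low m + int m"
      using start_fork[of i] i k by auto
    then obtain x where x: "1 \<le> x" "x \<le> m" "start i + int k = slot x" "v (start i + int k) = E x"
      by (rule fork_cases) (use False in auto)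
    have "x \<noteq> m" using x k by (auto simp: slot_m)
    then show ?thesis using x E_F_pos[of x "end_sign i * (-1) ^ k"] end_sign_power
      unfolding \<tau>_power_fork[OF i] by simp
  qed
  define N where "N = nat (low m + int m - start i)"
  have N: "start i + int N = low m + int m" using start_fork[of i] i unfolding N_def by auto
  obtain x where x: "1 \<le> x" "x \<le> m" "low m = slot x" using pos_onto[of right m "low m"] m by auto
  have "x < m" using x m by (cases "x = m") (auto simp: slot_m)
  have "(\<tau> ^^ N) (eta (Suc m) Q i) = - (\<lambda>t. E x t + (- (end_sign i * (-1) ^ N)) * F t)"
    unfolding \<tau>_power_fork[OF i] N using x by (simp add: fun_eq_iff)
  moreover have "(\<lambda>t. E x t + (- (end_sign i * (-1) ^ N)) * F t) \<in> \<Phi>"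
    using x \<open>x < m\<close> end_sign_power[of i N] by (intro E_F_pos) auto
  ultimately have neg: "(\<tau> ^^ N) (eta (Suc m) Q i) \<notin> \<Phi>" using uminus_pos_root by metis
  have "start i + int 0 \<le> low m + int m - 2" using start_fork[of i] i m by auto
  then have "len i < N" using ar_length_bounds(2)[of 0 \<tau> "Suc m" Q i N, OF _ neg] pos[of 0] by simp
  then show "start i + int (len i) < low m + int m" using N by linarith
  show "k \<le> len i" if "start i + int k \<le> low m + int m - 2"
    using that by (intro ar_length_bounds(1)[OF pos neg]) auto
qed

end

section \<open>Paths in the Auslander-Reiten quiver\<close>

context type_D_quiver
begin

text \<open>
  The coordinates of a vertex, read off from its row and its height, independently of the root
  attached to it.
\<close>

definition left_coord :: "nat \<times> int \<Rightarrow> int" where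
  "left_coord = (\<lambda>(i, p). start i + (\<xi> i - p) div 2)"

definition right_coord :: "nat \<times> int \<Rightarrow> int" where
  "right_coord = (\<lambda>(i, p). start i + (\<xi> i - p) div 2 + int (row i))"

lemma vertexE:
  assumes "x \<in> V"
  obtains i k where "x = (i, \<xi> i - 2 * int k)" "1 \<le> i" "i \<le> Suc m" "k \<le> len i"
  using assms unfolding ar_vertices_def by auto

lemma vertex_root: "vertex_root (i, \<xi> i - 2 * int k) = (\<tau> ^^ k) (eta (Suc m) Q i)"
  by (simp add: ar_root_def)

lemma coords: "left_coord (i, \<xi> i - 2 * int k) = start i + int k"
  "right_coord (i, \<xi> i - 2 * int k) = start i + int k + int (row i)"
  by (auto simp: left_coord_def right_coord_def)

lemma located_vertex:
  assumes "x \<in> V"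
  shows "located (vertex_root x) (left_coord x) (right_coord x)"
  using assms
proof (cases rule: vertexE)
  case (1 i k)
  show ?thesis
  proof (cases "i < m")
    case True
    then have "inner (low i + int k) (low i + int k + int i)"
      using 1 m by (auto simp: inner_def len_inner)
    then show ?thesis
      using 1 True inner_imp_located by (simp add: vertex_root coords \<tau>_power_inner start_def row_def)
  next
    case False
    then have i: "i = m \<or> i = Suc m" using 1 by auto
    have "start i + int k < low m + int m" using len_fork(1)[OF i] 1 by linarith
    then show ?thesis
      using 1 i start_fork[of i] located.fork[of "end_sign i * (-1) ^ k" "start i + int k"]
        end_sign_power[of i k]
      by (auto simp: vertex_root coords \<tau>_power_fork row_def)
  qed
qed

text \<open>
  Consider the step from row \<open>i - 1\<close> to row \<open>i\<close>,
  or from row \<open>m - 1\<close> to either end of the fork. If \<open>i - 1 \<rightarrow> i\<close>, then the start of the row stays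
  and the height drops by one; if \<open>i \<rightarrow> i - 1\<close>, then the start drops by one and the height grows
  by one. So the height plus twice the start drops by one in both cases.
\<close>

lemma height_start:
  assumes "1 \<le> i" "i \<le> Suc m"
  shows "\<xi> i + 2 * start i + int (row i) = \<xi> 1 + 2 * start 1 + 1"
proof -
  have step: "\<xi> j = \<xi> i - 1" if "(i, j) \<in> Q" for i j using \<xi> that by (simp add: height_function_def)
  have inner: "\<xi> (Suc i) + 2 * start (Suc i) + int (row (Suc i)) = \<xi> 1 + 2 * start 1 + 1"
    if "Suc i < m" for i
    using that
  proof (induction i)
    case 0
    then show ?case by (simp add: row_def)
  next
    case (Suc i)
    have "(Suc (Suc i), Suc i) \<in> Q \<longleftrightarrow> (Suc i, Suc (Suc i)) \<notin> Q"
      using Suc by (intro arrow_flip) (simp add: edge_iff_m)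
    then show ?case
      using Suc step[of "Suc i" "Suc (Suc i)"] step[of "Suc (Suc i)" "Suc i"]
      by (auto simp: row_def start_def right_def)
  qed
  show ?thesis
  proof (cases "i < m")
    case True
    then show ?thesis using inner[of "i - 1"] assms by simp
  next
    case False
    have "(i, m - Suc 0) \<in> Q \<longleftrightarrow> (m - Suc 0, i) \<notin> Q"
      using m False assms by (intro arrow_flip) (auto simp: edge_iff_m)
    moreover have "\<xi> (m - 1) + 2 * low m + int (m - 1) = \<xi> 1 + 2 * start 1 + 1"
      using inner[of "m - 2"] m low_m by (simp add: row_def start_def Suc_diff_Suc numeral_2_eq_2)
    ultimately show ?thesis
      using step[of i "m - 1"] step[of "m - 1" i] False m by (auto simp: row_def start_def of_nat_diff)
  qed
qed

lemma height_coords: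
  assumes "x \<in> V"
  shows "snd x + left_coord x + right_coord x = \<xi> 1 + 2 * start 1 + 1"
  using assms by (elim vertexE) (use height_start in \<open>force simp: coords\<close>)

lemma arrow_coords:
  assumes "(x, y) \<in> arrows"
  shows "left_coord y \<le> left_coord x" "right_coord y \<le> right_coord x"
    "left_coord y + right_coord y < left_coord x + right_coord x"
proof -
  obtain i j p where x: "x = (i, p)" "x \<in> V" and y: "y = (j, p + 1)" "y \<in> V"
    and ij: "{i, j} \<in> dynkin_edges (Suc m)"
    using assms unfolding ar_arrows_def by auto
  have "\<bar>int (row i) - int (row j)\<bar> = 1" using ij m unfolding edge_iff_m row_def by auto
  moreover have "right_coord x = left_coord x + int (row i)" "right_coord y = left_coord y + int (row j)"
    by (auto simp: x(1) y(1) left_coord_def right_coord_def)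
  moreover have "left_coord x + right_coord x = left_coord y + right_coord y + 1"
    using height_coords[OF x(2)] height_coords[OF y(2)] x(1) y(1) by simp
  ultimately show "left_coord y \<le> left_coord x" "right_coord y \<le> right_coord x"
    "left_coord y + right_coord y < left_coord x + right_coord x" by linarith+
qed

lemma path_coords:
  assumes "(x, y) \<in> arrows\<^sup>*"
  shows "left_coord y \<le> left_coord x \<and> right_coord y \<le> right_coord x \<and>
    (x = y \<or> left_coord y + right_coord y < left_coord x + right_coord x)"
  using assms
proof induction
  case (step y z)
  then show ?case using arrow_coords[OF step(2)] by auto
qed simp

text \<open>
  This relation contains \<open>\<prec>\<close>, so its linear extensions are compatible orders, and it can be decided
  by comparing coordinates, without exhibiting paths.
\<close>

definition less :: "vec \<Rightarrow> vec \<Rightarrow> bool" where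
  "less \<alpha> \<beta> \<longleftrightarrow> (\<exists>k l k' l'. located \<alpha> k l \<and> located \<beta> k' l' \<and> k \<le> k' \<and> l \<le> l' \<and> (k, l) \<noteq> (k', l'))"

lemma lessD:
  assumes "less \<alpha> \<beta>" "located \<alpha> k l" "located \<beta> k' l'"
  shows "k \<le> k'" "l \<le> l'" "(k, l) \<noteq> (k', l')"
proof -
  obtain a b c d where *: "located \<alpha> a b" "located \<beta> c d" "a \<le> c" "b \<le> d" "(a, b) \<noteq> (c, d)"
    using assms(1) unfolding less_def by auto
  have "a = k" "b = l" "c = k'" "d = l'"
    using located_unique[OF *(1) assms(2)] located_unique[OF *(2) assms(3)] by auto
  then show "k \<le> k'" "l \<le> l'" "(k, l) \<noteq> (k', l')" using * by auto
qed

lemma less_trans: "less \<alpha> \<beta> \<Longrightarrow> less \<beta> \<gamma> \<Longrightarrow> less \<alpha> \<gamma>"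
proof -
  assume "less \<alpha> \<beta>" "less \<beta> \<gamma>"
  then obtain a b c d a' b' where c: "located \<alpha> a a'" "located \<beta> b b'" "located \<gamma> c d"
    unfolding less_def by blast
  have "a \<le> c" "a' \<le> d" "(a, a') \<noteq> (c, d)"
    using lessD[OF \<open>less \<alpha> \<beta>\<close> c(1,2)] lessD[OF \<open>less \<beta> \<gamma>\<close> c(2,3)] by auto
  then show ?thesis using c unfolding less_def by blast
qed

lemma prec_less: "prec (Suc m) Q \<xi> \<tau> \<alpha> \<beta> \<Longrightarrow> less \<alpha> \<beta>"
proof -
  assume "prec (Suc m) Q \<xi> \<tau> \<alpha> \<beta>"
  then obtain x y where x: "x \<in> V" "vertex_root x = \<alpha>" and y: "y \<in> V" "vertex_root y = \<beta>"
    and ne: "\<alpha> \<noteq> \<beta>" and path: "(y, x) \<in> arrows\<^sup>*"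
    unfolding prec_def by auto
  have "x \<noteq> y" using x y ne by auto
  then show ?thesis
    using path_coords[OF path] located_vertex[OF x(1)] located_vertex[OF y(1)] x(2) y(2)
    unfolding less_def by fastforce
qed

definition rank :: "vec \<Rightarrow> int" where
  "rank \<alpha> = (THE r. \<exists>k l. located \<alpha> k l \<and> r = k + l)"

lemma rank_located: "located \<alpha> k l \<Longrightarrow> rank \<alpha> = k + l"
  unfolding rank_def by (intro the_equality) (auto dest: located_unique)

lemma less_rank: "less \<alpha> \<beta> \<Longrightarrow> rank \<alpha> < rank \<beta>"
  by (auto simp: less_def rank_located)

text \<open>
  The vertex with given coordinates, for rows before the fork.
\<close>

definition vertex :: "int \<Rightarrow> int \<Rightarrow> nat \<times> int" where
  "vertex k l = (nat (l - k), \<xi> 1 + 2 * start 1 + 1 - k - l)"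

lemma inner_vertex:
  assumes "inner k l"
  shows "vertex k l \<in> V" "vertex_root (vertex k l) = v k - v l"
proof -
  define r where "r = nat (l - k)"
  define j where "j = nat (k - low r)"
  have r: "1 \<le> r" "r < m" "int r = l - k" and j: "int j = k - low r" "j \<le> m - 1"
    using assms unfolding inner_def r_def j_def by auto
  have vertex: "vertex k l = (r, \<xi> r - 2 * int j)"
    using height_start[of r] r j by (simp add: vertex_def r_def[symmetric] row_def start_def)
  have "1 \<le> r \<and> r \<le> Suc m \<and> j \<le> len r" using r j len_inner[of r] by simp
  then show "vertex k l \<in> V" unfolding vertex ar_vertices_def by blast
  have "low r + int j = k" "low r + int j + int r = l" using r j by auto
  then show "vertex_root (vertex k l) = v k - v l"
    unfolding vertex vertex_root \<tau>_power_inner[OF r(1,2)] by (simp only:)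
qed

lemma inner_arrow_left:
  assumes "inner k l" "inner (k - 1) l"
  shows "(vertex k l, vertex (k - 1) l) \<in> arrows"
proof -
  define r where "r = nat (l - k)"
  have "nat (l - (k - 1)) = Suc r" "1 \<le> r" "Suc r < m" using assms unfolding inner_def r_def by auto
  moreover from this have edge: "{r, Suc r} \<in> dynkin_edges (Suc m)" by (simp add: edge_iff_m)
  moreover define p where "p = \<xi> 1 + 2 * start 1 + 1 - k - l"
  ultimately have "vertex k l = (r, p)" "vertex (k - 1) l = (Suc r, p + 1)"
    by (auto simp: vertex_def r_def)
  then show ?thesis
    using inner_vertex(1)[OF assms(1)] inner_vertex(1)[OF assms(2)] edge
    unfolding ar_arrows_def by auto
qed

lemma inner_arrow_right:
  assumes "inner k l" "inner k (l - 1)"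
  shows "(vertex k l, vertex k (l - 1)) \<in> arrows"
proof -
  define r where "r = nat (l - 1 - k)"
  have "nat (l - k) = Suc r" "1 \<le> r" "Suc r < m" using assms unfolding inner_def r_def by auto
  moreover from this have edge: "{Suc r, r} \<in> dynkin_edges (Suc m)" by (simp add: edge_iff_m)
  moreover define p where "p = \<xi> 1 + 2 * start 1 + 1 - k - l"
  ultimately have "vertex k l = (Suc r, p)" "vertex k (l - 1) = (r, p + 1)"
    by (auto simp: vertex_def r_def algebra_simps)
  then show ?thesis
    using inner_vertex(1)[OF assms(1)] inner_vertex(1)[OF assms(2)] edge
    unfolding ar_arrows_def by auto
qed

text \<open>
  The starts of the rows decrease while their right ends \<open>low r + r\<close> increase, so each line on which
  one coordinate is constant meets the region in an interval.
  It follows that a path along such a line does not leave the quiver.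
\<close>

lemma inner_convex_left:
  assumes "inner k l" "inner k' l" "k' \<le> j" "j \<le> k"
  shows "inner j l"
proof -
  have "low (nat (l - j)) + int (nat (l - j)) \<le> low (nat (l - k')) + int (nat (l - k'))"
    "low (nat (l - k)) + int (nat (l - k)) \<le> low (nat (l - j)) + int (nat (l - j))"
    using assms by (intro lo_plus_mono; linarith)+
  then show ?thesis using assms unfolding inner_def by linarith
qed

lemma inner_convex_right:
  assumes "inner k l" "inner k l'" "l' \<le> j" "j \<le> l"
  shows "inner k j"
proof -
  have "low (nat (j - k)) \<le> low (nat (l' - k))" "low (nat (l - k)) \<le> low (nat (j - k))"
    using assms by (intro lo_antimono; linarith)+
  then show ?thesis using assms unfolding inner_def by linarith
qed

lemma path_left:
  assumes "inner k l" "inner k' l" "k' \<le> k"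
  shows "(vertex k l, vertex k' l) \<in> arrows\<^sup>*"
proof -
  have "(vertex j l, vertex k' l) \<in> arrows\<^sup>*" if "k' \<le> j" "j \<le> k" for j
    using that
  proof (induction j rule: int_ge_induct)
    case (step j)
    have "inner j l" "inner (j + 1) l" using inner_convex_left[OF assms(1,2)] step by auto
    then show ?case using inner_arrow_left[of "j + 1" l] step by (auto intro: converse_rtrancl_into_rtrancl)
  qed simp
  then show ?thesis using assms(3) by simp
qed

lemma path_right:
  assumes "inner k l" "inner k l'" "l' \<le> l"
  shows "(vertex k l, vertex k l') \<in> arrows\<^sup>*"
proof -
  have "(vertex k j, vertex k l') \<in> arrows\<^sup>*" if "l' \<le> j" "j \<le> l" for j
    using that
  proof (induction j rule: int_ge_induct)
    case (step j)
    have "inner k j" "inner k (j + 1)" using inner_convex_right[OF assms(1,2)] step by auto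
    then show ?case using inner_arrow_right[of k "j + 1"] step by (auto intro: converse_rtrancl_into_rtrancl)
  qed simp
  then show ?thesis using assms(3) by simp
qed

lemma path_imp_prec:
  assumes "inner k l" "inner k' l'" "(vertex k' l', vertex k l) \<in> arrows\<^sup>*" "(k, l) \<noteq> (k', l')"
  shows "prec (Suc m) Q \<xi> \<tau> (v k - v l) (v k' - v l')"
proof -
  have "v k - v l \<noteq> v k' - v l'"
    using located_unique[OF inner_imp_located(1)[OF assms(1)], of k' l']
      inner_imp_located(1)[OF assms(2)] assms(4) by auto
  then show ?thesis using inner_vertex[OF assms(1)] inner_vertex[OF assms(2)] assms(3)
    unfolding prec_def by blast
qed

end

section \<open>The pairs of a root that is not multiplicity free\<close>

lemma eps_sum_eq:
  assumes "\<And>t. eps x t + eps y t = eps a t + eps b t" "a \<noteq> b"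
  shows "x = a \<and> y = b \<or> x = b \<and> y = a"
  using assms(1)[of a] assms(1)[of b] assms(2) by (auto simp: eps_def split: if_splits)

text \<open>
  The subtracted vector has to cancel one of the first two.
\<close>

lemma mixed_sum_eq:
  assumes sum: "eps x + eps y + (eps z - eps w) = eps a + eps b" and "a \<noteq> b" "x \<noteq> y" "z \<noteq> w"
  obtains "{x, y} = {a, w}" "z = b" | "{x, y} = {b, w}" "z = a"
proof -
  have H: "eps x t + eps y t + (eps z t - eps w t) = eps a t + eps b t" for t
    using fun_cong[OF sum, of t] by simp
  have "x = w \<or> y = w" using H[of w] assms(4) by (auto simp: eps_def split: if_splits)
  then show thesis
  proof
    assume "x = w"
    then have "eps y t + eps z t = eps a t + eps b t" for t using H[of t] by simp
    from eps_sum_eq[OF this \<open>a \<noteq> b\<close>] show thesis using that \<open>x = w\<close> by auto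
  next
    assume "y = w"
    then have "eps x t + eps z t = eps a t + eps b t" for t using H[of t] by simp
    from eps_sum_eq[OF this \<open>a \<noteq> b\<close>] show thesis using that \<open>y = w\<close> by auto
  qed
qed

text \<open>
  By the coordinate sum, one of the two roots is a sum and the other a difference of basis vectors.
\<close>

lemma pos_root_sum_cases:
  assumes \<alpha>: "\<alpha> \<in> pos_roots n" and \<beta>: "\<beta> \<in> pos_roots n" and sum: "\<alpha> + \<beta> = eps a + eps b"
    and "a < b"
  obtains c \<alpha>' \<beta>' where "a < c" "c \<noteq> b" "c \<le> n"
    "\<alpha> = \<alpha>' \<and> \<beta> = \<beta>' \<or> \<alpha> = \<beta>' \<and> \<beta> = \<alpha>'"
    "\<alpha>' = eps a - eps c \<and> \<beta>' = eps b + eps c \<or> b < c \<and> \<alpha>' = eps a + eps c \<and> \<beta>' = eps b - eps c"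
proof -
  note result = that
  have mixed: thesis if "\<alpha>' = eps x + eps y" "x < y" "y \<le> n" "\<beta>' = eps z - eps w" "z < w" "w \<le> n"
    "\<alpha> = \<alpha>' \<and> \<beta> = \<beta>' \<or> \<alpha> = \<beta>' \<and> \<beta> = \<alpha>'" for \<alpha>' \<beta>' x y z w
  proof -
    have "eps x + eps y + (eps z - eps w) = eps a + eps b"
      using that(1,4,7) sum by (auto simp: add.commute)
    then show thesis
    proof (rule mixed_sum_eq)
      assume "{x, y} = {a, w}" "z = b"
      moreover from this have "eps x + eps y = eps a + eps w"
        by (auto simp: doubleton_eq_iff add.commute)
      ultimately show thesis using that \<open>a < b\<close> result[of w \<alpha>' \<beta>'] by auto
    next
      assume "{x, y} = {b, w}" "z = a"
      moreover from this have "eps x + eps y = eps b + eps w"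
        by (auto simp: doubleton_eq_iff add.commute)
      ultimately show thesis using that \<open>a < b\<close> result[of w \<beta>' \<alpha>']
        by (auto simp: doubleton_eq_iff)
    qed (use that \<open>a < b\<close> in auto)
  qed
  obtain x y where x: "x < y" "y \<le> n" "\<alpha> = eps x + eps y \<or> \<alpha> = eps x - eps y"
    using \<alpha> by (auto simp: pos_roots_def)
  obtain z w where z: "z < w" "w \<le> n" "\<beta> = eps z + eps w \<or> \<beta> = eps z - eps w"
    using \<beta> by (auto simp: pos_roots_def)
  have at: "\<alpha> t + \<beta> t = eps a t + eps b t" for t using fun_cong[OF sum, of t] by simp
  consider "\<alpha> = eps x + eps y" "\<beta> = eps z + eps w" | "\<alpha> = eps x - eps y" "\<beta> = eps z - eps w"
    | "\<alpha> = eps x + eps y" "\<beta> = eps z - eps w" | "\<alpha> = eps x - eps y" "\<beta> = eps z + eps w"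
    using x z by auto
  then show thesis
  proof cases
    case 1
    have H: "eps x t + eps y t + eps z t + eps w t = eps a t + eps b t" for t using at[of t] 1 by simp
    have False
      using H[of x] H[of y] H[of z] \<open>x < y\<close> \<open>z < w\<close> \<open>a < b\<close>
      by (auto simp: eps_def split: if_splits)
    then show thesis ..
  next
    case 2
    have H: "eps x t - eps y t + eps z t - eps w t = eps a t + eps b t" for t using at[of t] 2 by simp
    have False
      using H[of y] H[of w] \<open>x < y\<close> \<open>z < w\<close>
      by (auto simp: eps_def split: if_splits)
    then show thesis ..
  next
    case 3
    then show thesis using mixed[of \<alpha> x y \<beta> z w] x z by auto
  next
    case 4
    then show thesis using mixed[of \<beta> z w \<alpha> x y] x z by auto
  qed
qed

context type_D_quiver
begin

text \<open>
  The case \<open>c = m\<close> stands for the last index on the cycle. Its sign may exchange the two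
  alternatives, which is why the list is symmetric in them.
\<close>

lemma E_sum_cases:
  assumes \<alpha>: "\<alpha> \<in> \<Phi>" and \<beta>: "\<beta> \<in> \<Phi>" and sum: "\<alpha> + \<beta> = E a + E b"
    and ab: "1 \<le> a" "a < b" "b < m"
  obtains \<alpha>' \<beta>' where "\<alpha> = \<alpha>' \<and> \<beta> = \<beta>' \<or> \<alpha> = \<beta>' \<and> \<beta> = \<alpha>'"
    "(\<exists>c. a < c \<and> c < b \<and> \<alpha>' = E a - E c \<and> \<beta>' = E b + E c) \<or>
     (\<exists>c. b < c \<and> c \<le> m \<and> (\<alpha>' = E a - E c \<and> \<beta>' = E b + E c \<or> \<alpha>' = E a + E c \<and> \<beta>' = E b - E c)) \<or>
     (\<exists>d. (d = 1 \<or> d = -1) \<and> \<alpha>' = (\<lambda>t. E a t + d * F t) \<and> \<beta>' = (\<lambda>t. E b t + - d * F t))"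
proof -
  have eps: "E j = eps j" if "j < m" for j using that by (simp add: fun_eq_iff E_def)
  have "\<alpha> + \<beta> = eps a + eps b" using sum ab by (simp add: eps)
  from pos_root_sum_cases[OF \<alpha> \<beta> this ab(2)]
  obtain c \<alpha>' \<beta>' where c: "a < c" "c \<noteq> b" "c \<le> Suc m"
    and *: "\<alpha> = \<alpha>' \<and> \<beta> = \<beta>' \<or> \<alpha> = \<beta>' \<and> \<beta> = \<alpha>'"
    and **: "\<alpha>' = eps a - eps c \<and> \<beta>' = eps b + eps c \<or>
      b < c \<and> \<alpha>' = eps a + eps c \<and> \<beta>' = eps b - eps c" by metis
  have "c < b \<or> b < c \<and> c < m \<or> c = m \<or> c = Suc m" using c by linarith
  then consider "c < b" | "b < c" "c < m" | "c = last_index" | "c = fixed_index"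
    by (cases same_ends) (auto simp: last_index_def fixed_index_def)
  then show thesis
  proof cases
    case 1
    then have "\<alpha>' = E a - E c \<and> \<beta>' = E b + E c" using ** ab by (simp add: eps)
    then show thesis using that[OF *] c 1 by blast
  next
    case 2
    then have "\<alpha>' = E a - E c \<and> \<beta>' = E b + E c \<or> \<alpha>' = E a + E c \<and> \<beta>' = E b - E c"
      using ** ab by (simp add: eps)
    then show thesis using that[OF *] 2 less_imp_le[of c m] by blast
  next
    case 3
    have "E m = eps c \<or> E m = - eps c" using 3 by (auto simp: fun_eq_iff E_def last_sign_def)
    then have "\<alpha>' = E a - E m \<and> \<beta>' = E b + E m \<or> \<alpha>' = E a + E m \<and> \<beta>' = E b - E m"
      using ** ab eps by auto
    then show thesis using that[OF *] ab by blast
  next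
    case 4
    then have "\<alpha>' = (\<lambda>t. E a t + (-1) * F t) \<and> \<beta>' = (\<lambda>t. E b t + - (-1) * F t) \<or>
      \<alpha>' = (\<lambda>t. E a t + 1 * F t) \<and> \<beta>' = (\<lambda>t. E b t + - 1 * F t)"
      using ** ab by (auto simp: fun_eq_iff F_def eps)
    then show thesis using that[OF *] by blast
  qed
qed

end

text \<open>
  With \<open>(s, t)\<close> the coordinates of \<open>\<gamma>\<close>, these are the possible coordinates of the members of a
  pair: \<open>outer_kind\<close> is that of the non-minimal pairs, and \<open>inner_kind\<close> all others. The last case
  of \<open>inner_kind\<close> comes from the two pairs that involve the negated basis vector, and the first
  case occurs once for each \<open>c > b\<close> on the cycle; the cases in the middle stem from the pairs
  \<open>\<epsilon>\<^sub>a - \<epsilon>\<^sub>c, \<epsilon>\<^sub>b + \<epsilon>\<^sub>c\<close> with \<open>a < c < b\<close>, which can also fall into the first one.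
\<close>

definition inner_kind :: "int \<Rightarrow> int \<Rightarrow> int \<Rightarrow> int \<Rightarrow> int \<Rightarrow> int \<Rightarrow> int \<Rightarrow> bool" where
  "inner_kind m s t k l k' l' \<longleftrightarrow>
    (\<exists>u. s < u \<and> u < t \<and> k = s \<and> l = u \<and> k' = u \<and> l' = t) \<or>
    (\<exists>u. t < u \<and> u < s + m \<and> k = u - m \<and> l = t \<and> k' = u \<and> l' = s + m) \<or>
    (\<exists>u. t < u \<and> u < s + m \<and> k = t - m \<and> l = u - m \<and> k' = s \<and> l' = u) \<or>
    (k = t - m \<and> l = t \<and> k' = s \<and> l' = s + m)"

definition outer_kind :: "int \<Rightarrow> int \<Rightarrow> int \<Rightarrow> int \<Rightarrow> int \<Rightarrow> int \<Rightarrow> int \<Rightarrow> bool" where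
  "outer_kind m s t k l k' l' \<longleftrightarrow>
    (\<exists>u. s < u \<and> u < t \<and> k = t - m \<and> l = u \<and> k' = u \<and> l' = s + m)"

lemma kind_ordered:
  assumes "inner_kind m s t k l k' l' \<or> outer_kind m s t k l k' l'" "s < t" "t < s + m"
  shows "k \<le> k'" "l \<le> l'" "k < k' \<or> l < l'"
  using assms unfolding inner_kind_def outer_kind_def by auto

text \<open>
  For two pairs of the same kind, moving \<open>u\<close> moves both members in the same
  direction, and pairs of different kinds differ too much in one coordinate.
\<close>

lemma inner_kind_minimal:
  assumes "inner_kind m s t k l k' l'" "inner_kind m s t p q p' q' \<or> outer_kind m s t p q p' q'"
    and "s < t" "t < s + m" "k \<le> p" "l \<le> q" "p' \<le> k'" "q' \<le> l'"
  shows "k = p" "l = q"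
  using assms unfolding inner_kind_def outer_kind_def by auto

locale type_D_root = type_D_quiver +
  fixes a b :: nat
  assumes ab: "1 \<le> a" "a < b" "b < m"
begin

text \<open>
  Of \<open>a\<close> and \<open>b\<close>, \<open>f\<close> is the one placed further left. As \<open>\<gamma> = v (slot g) - v (slot f + m)\<close>, this
  yields the coordinates \<open>(s, t)\<close> of \<open>\<gamma>\<close>.
\<close>

definition f :: nat where "f = (if slot a < slot b then a else b)"
definition g :: nat where "g = (if slot a < slot b then b else a)"
definition s :: int where "s = slot g"
definition t :: int where "t = slot f + int m"

abbreviation "\<gamma> \<equiv> E a + E b"

text \<open>
  The two pairs for an index \<open>c > b\<close>. Such a \<open>c\<close> is placed outside the interval between \<open>f\<close> and
  \<open>g\<close>, and the side decides which of the two encloses the other. In both cases \<open>pivot c\<close> is the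
  coordinate that the four roots have in common.
\<close>

definition outer_pair :: "nat \<Rightarrow> vec \<times> vec" where
  "outer_pair c = (if slot g < slot c then (E f - E c, E g + E c) else (E f + E c, E g - E c))"

definition inner_pair :: "nat \<Rightarrow> vec \<times> vec" where
  "inner_pair c = (if slot g < slot c then (E g - E c, E f + E c) else (E g + E c, E f - E c))"

definition pivot :: "nat \<Rightarrow> int" where
  "pivot c = (if slot g < slot c then slot c else slot c + int m)"

lemma fg: "1 \<le> f" "f \<le> b" "1 \<le> g" "g \<le> b" "slot f < slot g" "E f + E g = \<gamma>"
  "f = a \<and> g = b \<or> f = b \<and> g = a"
proof -
  have "slot a \<noteq> slot b" using pos_eq_iff[of a b right] ab by simp
  then show "1 \<le> f" "f \<le> b" "1 \<le> g" "g \<le> b" "slot f < slot g" "E f + E g = \<gamma>"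
    "f = a \<and> g = b \<or> f = b \<and> g = a"
    using ab by (auto simp: f_def g_def add.commute)
qed

lemma slot_bounds: "1 \<le> x \<Longrightarrow> x \<le> m \<Longrightarrow> low m \<le> slot x \<and> slot x < low m + int m"
  using pos_bounds by blast

lemma st: "s < t" "t < s + int m"
  using fg slot_bounds[of f] slot_bounds[of g] ab by (auto simp: s_def t_def)

lemma located_\<gamma>: "located \<gamma> s t"
  using located.across[of g f] fg ab by (auto simp: s_def t_def add.commute)

lemma slot_outside:
  assumes "b < c"
  shows "slot g < slot c \<or> slot c < slot f"
  using pos_outside[of f c right] pos_outside[of g c right]
    pos_bounds[of f "c - 1" right] pos_bounds[of g "c - 1" right] fg assms by auto

lemma located_pairs:
  assumes c: "b < c" "c \<le> m"
  shows "located (fst (outer_pair c)) (t - int m) (pivot c)"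
    "located (snd (outer_pair c)) (pivot c) (s + int m)"
    "located (fst (inner_pair c)) s (pivot c)"
    "located (snd (inner_pair c)) (pivot c) t"
    "s < pivot c" "pivot c < t"
proof -
  have b: "low m \<le> slot x" "slot x < low m + int m" if "x = c \<or> x = f \<or> x = g" for x
    using slot_bounds[of x] fg c ab that by auto
  have "f < c" "g < c" using fg c by auto
  note facts = this fg(1,3,5) c b[of c] b[of f] b[of g] ab
  show "located (fst (outer_pair c)) (t - int m) (pivot c)"
    "located (snd (outer_pair c)) (pivot c) (s + int m)"
    "located (fst (inner_pair c)) s (pivot c)"
    "located (snd (inner_pair c)) (pivot c) t"
    "s < pivot c" "pivot c < t"
    using slot_outside[OF c(1)] facts located.right[of f c] located.right[of g c]
      located.left[of f c] located.left[of g c]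
      located.across[of c f] located.across[of c g] located.across[of f c] located.across[of g c]
    by (auto simp: outer_pair_def inner_pair_def pivot_def s_def t_def add.commute)
qed

text \<open>
  For \<open>c > b\<close> the coordinates are those of \<open>located_pairs\<close>. For \<open>a < c < b\<close>, the place of \<open>b\<close> is
  beyond those of \<open>a\<close> and \<open>c\<close>, which leaves four possible arrangements of the three places.
\<close>

lemma pair_kinds:
  assumes "\<alpha> \<in> \<Phi>" "\<beta> \<in> \<Phi>" "\<alpha> + \<beta> = \<gamma>"
  obtains \<alpha>' \<beta>' k l k' l' where "\<alpha> = \<alpha>' \<and> \<beta> = \<beta>' \<or> \<alpha> = \<beta>' \<and> \<beta> = \<alpha>'"
    "located \<alpha>' k l" "located \<beta>' k' l'"
    "inner_kind (int m) s t k l k' l' \<or>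
     outer_kind (int m) s t k l k' l' \<and> (\<alpha>', \<beta>') \<in> outer_pair ` {b<..m}"
proof -
  note result = that
  obtain \<alpha>' \<beta>' where *: "\<alpha> = \<alpha>' \<and> \<beta> = \<beta>' \<or> \<alpha> = \<beta>' \<and> \<beta> = \<alpha>'"
    and **: "(\<exists>c. a < c \<and> c < b \<and> \<alpha>' = E a - E c \<and> \<beta>' = E b + E c) \<or>
     (\<exists>c. b < c \<and> c \<le> m \<and> (\<alpha>' = E a - E c \<and> \<beta>' = E b + E c \<or> \<alpha>' = E a + E c \<and> \<beta>' = E b - E c)) \<or>
     (\<exists>d. (d = 1 \<or> d = -1) \<and> \<alpha>' = (\<lambda>t. E a t + d * F t) \<and> \<beta>' = (\<lambda>t. E b t + - d * F t))"
    by (rule E_sum_cases[OF assms ab])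
  have swap: "\<alpha> = \<beta>' \<and> \<beta> = \<alpha>' \<or> \<alpha> = \<alpha>' \<and> \<beta> = \<beta>'" using * by auto
  have between: thesis if c: "a < c" "c < b" and \<alpha>': "\<alpha>' = E a - E c" "\<beta>' = E b + E c" for c
  proof -
    have bd: "low m \<le> slot x" "slot x < low m + int m" if "x = a \<or> x = b \<or> x = c" for x
      using slot_bounds[of x] c ab that by auto
    note bds = bd[of a] bd[of b] bd[of c]
    have out: "slot a < slot b \<and> slot c < slot b \<or> slot b < slot a \<and> slot b < slot c"
      using pos_outside[of a b right] pos_outside[of c b right]
        pos_bounds[of a "b - 1" right] pos_bounds[of c "b - 1" right] c ab by auto
    have ne: "slot a \<noteq> slot c" using pos_eq_iff[of a c right] c ab by auto
    consider "slot c < slot a" "slot a < slot b" | "slot a < slot c" "slot c < slot b"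
      | "slot b < slot a" "slot a < slot c" | "slot b < slot c" "slot c < slot a"
      using out ne by linarith
    then show thesis
    proof cases
      case 1
      have st: "s = slot b" "t = slot a + int m" using 1 by (auto simp: s_def t_def f_def g_def)
      have "located \<beta>' (slot b) (slot c + int m)" "located \<alpha>' (slot c + int m) (slot a + int m)"
        using located.across[of b c] located.left[of a c] 1 c ab \<alpha>' by auto
      moreover have "inner_kind (int m) s t (slot b) (slot c + int m) (slot c + int m) (slot a + int m)"
        using 1 bds st by (auto simp: inner_kind_def)
      ultimately show thesis using result[OF swap] by blast
    next
      case 2
      have st: "s = slot b" "t = slot a + int m" using 2 by (auto simp: s_def t_def f_def g_def)
      have "located \<beta>' (slot b) (slot c + int m)" "located \<alpha>' (slot a) (slot c)"
        using located.across[of b c] located.right[of a c] 2 c ab \<alpha>' by auto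
      moreover have "inner_kind (int m) s t (slot a) (slot c) (slot b) (slot c + int m)"
        using 2 bds st by (auto simp: inner_kind_def)
      ultimately show thesis using result[OF *] by blast
    next
      case 3
      have st: "s = slot a" "t = slot b + int m" using 3 by (auto simp: s_def t_def f_def g_def)
      have "located \<alpha>' (slot a) (slot c)" "located \<beta>' (slot c) (slot b + int m)"
        using located.across[of c b] located.right[of a c] 3 c ab \<alpha>' by (auto simp: add.commute)
      moreover have "inner_kind (int m) s t (slot a) (slot c) (slot c) (slot b + int m)"
        using 3 bds st by (auto simp: inner_kind_def)
      ultimately show thesis using result[OF *] by blast
    next
      case 4
      have st: "s = slot a" "t = slot b + int m" using 4 by (auto simp: s_def t_def f_def g_def)
      have "located \<beta>' (slot c) (slot b + int m)" "located \<alpha>' (slot c + int m) (slot a + int m)"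
        using located.across[of c b] located.left[of a c] 4 c ab \<alpha>' by (auto simp: add.commute)
      moreover have "inner_kind (int m) s t (slot c) (slot b + int m) (slot c + int m) (slot a + int m)"
        using 4 bds st by (auto simp: inner_kind_def)
      ultimately show thesis using result[OF swap] by blast
    qed
  qed
  have both: thesis if c: "b < c" "c \<le> m" and "(\<alpha>', \<beta>') = outer_pair c \<or> (\<beta>', \<alpha>') = outer_pair c \<or>
      (\<alpha>', \<beta>') = inner_pair c \<or> (\<beta>', \<alpha>') = inner_pair c" for c
  proof -
    note loc = located_pairs[OF c]
    have "outer_kind (int m) s t (t - int m) (pivot c) (pivot c) (s + int m)"
      "inner_kind (int m) s t s (pivot c) (pivot c) t"
      using loc(5,6) by (auto simp: outer_kind_def inner_kind_def)
    moreover have "outer_pair c \<in> outer_pair ` {b<..m}" using c by auto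
    ultimately show thesis using that(3) loc(1-4) result[OF *] result[OF swap]
      by (metis fst_conv snd_conv)
  qed
  have beyond: thesis if c: "b < c" "c \<le> m"
      and "\<alpha>' = E a - E c \<and> \<beta>' = E b + E c \<or> \<alpha>' = E a + E c \<and> \<beta>' = E b - E c" for c
    using both[OF c] fg(7) that(3) by (auto simp: outer_pair_def inner_pair_def)
  have fork: thesis if d: "d = 1 \<or> d = -1"
    and \<alpha>': "\<alpha>' = (\<lambda>t. E a t + d * F t)" "\<beta>' = (\<lambda>t. E b t + - d * F t)" for d :: real
  proof -
    have loc: "located (\<lambda>t. E x t + c * F t) (slot x) (slot x + int m)"
      if "x = a \<or> x = b" "c = 1 \<or> c = -1" for x c
    proof -
      have "v (slot x) = E x" using that ab by (auto simp: fun_eq_iff)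
      then show ?thesis using located.fork[of c "slot x"] slot_bounds[of x] that ab by auto
    qed
    have "located \<alpha>' (slot a) (slot a + int m)" "located \<beta>' (slot b) (slot b + int m)"
      unfolding \<alpha>' using d loc[of a d] loc[of b "- d"] by auto
    moreover have "inner_kind (int m) s t (slot f) (slot f + int m) (slot g) (slot g + int m)"
      by (simp add: inner_kind_def s_def t_def)
    ultimately show thesis using result[OF *] result[OF swap] fg(7) by metis
  qed
  from ** between beyond fork show thesis by blast
qed

lemma ordered_pair_kinds:
  assumes "\<alpha> \<in> \<Phi>" "\<beta> \<in> \<Phi>" "\<alpha> + \<beta> = \<gamma>" "less \<alpha> \<beta>"
  obtains k l k' l' where "located \<alpha> k l" "located \<beta> k' l'"
    "inner_kind (int m) s t k l k' l' \<or>
     outer_kind (int m) s t k l k' l' \<and> (\<alpha>, \<beta>) \<in> outer_pair ` {b<..m}"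
proof -
  obtain \<alpha>' \<beta>' k l k' l' where *: "\<alpha> = \<alpha>' \<and> \<beta> = \<beta>' \<or> \<alpha> = \<beta>' \<and> \<beta> = \<alpha>'"
    and loc: "located \<alpha>' k l" "located \<beta>' k' l'"
    and kind: "inner_kind (int m) s t k l k' l' \<or>
     outer_kind (int m) s t k l k' l' \<and> (\<alpha>', \<beta>') \<in> outer_pair ` {b<..m}"
    using pair_kinds[OF assms(1-3)] by metis
  have ord: "k \<le> k'" "l \<le> l'" "k < k' \<or> l < l'" using kind_ordered[OF _ st] kind by blast+
  have "\<not> (\<alpha> = \<beta>' \<and> \<beta> = \<alpha>')"
    using lessD[OF assms(4), of k' l' k l] loc ord by auto
  then show thesis using that loc kind * by blast
qed

lemma root_pairs_iff:
  "(\<alpha>, \<beta>) \<in> root_pairs (Suc m) Q \<xi> \<tau> \<gamma> \<longleftrightarrow>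
    \<alpha> \<in> \<Phi> \<and> \<beta> \<in> \<Phi> \<and> \<alpha> + \<beta> = \<gamma> \<and> prec (Suc m) Q \<xi> \<tau> \<alpha> \<beta>"
  by (simp add: root_pairs_def)

text \<open>
  The path through \<open>\<beta>\<close>, \<open>\<beta>'\<close>, \<open>\<gamma>\<close>, \<open>\<alpha>'\<close>, \<open>\<alpha>\<close> changes one coordinate at a time, within the
  rows before the fork.
\<close>

lemma outer_pair_non_minimal:
  assumes c: "b < c" "c \<le> m"
  shows "outer_pair c \<in> non_minimal_pairs (Suc m) Q \<xi> \<tau> \<gamma>"
proof -
  obtain \<alpha> \<beta> \<alpha>' \<beta>' where pairs: "outer_pair c = (\<alpha>, \<beta>)" "inner_pair c = (\<alpha>', \<beta>')" by fastforce
  define u where "u = pivot c"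
  note loc = located_pairs[OF c, unfolded pairs fst_conv snd_conv u_def[symmetric]]
  note su = loc(5) and ut = loc(6)
  have small: "u < t - int m + int m" "s + int m < u + int m" "u < s + int m" "t < u + int m"
    using su ut st by auto
  note i1 = located_imp_inner[OF loc(1) small(1)]
    and i2 = located_imp_inner[OF loc(3) small(3)]
    and i3 = located_imp_inner[OF located_\<gamma> st(2)]
    and i4 = located_imp_inner[OF loc(4) small(4)]
    and i5 = located_imp_inner[OF loc(2) small(2)]
  have p12: "(vertex s u, vertex (t - int m) u) \<in> arrows\<^sup>*"
    using path_left[OF i2(1) i1(1)] st by simp
  have p23: "(vertex s t, vertex s u) \<in> arrows\<^sup>*" using path_right[OF i3(1) i2(1)] ut by simp
  have p34: "(vertex u t, vertex s t) \<in> arrows\<^sup>*" using path_left[OF i4(1) i3(1)] su by simp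
  have p45: "(vertex u (s + int m), vertex u t) \<in> arrows\<^sup>*"
    using path_right[OF i5(1) i4(1)] st by simp
  have prec: "prec (Suc m) Q \<xi> \<tau> \<alpha> \<alpha>'" "prec (Suc m) Q \<xi> \<tau> \<alpha>' \<gamma>"
    "prec (Suc m) Q \<xi> \<tau> \<gamma> \<beta>'" "prec (Suc m) Q \<xi> \<tau> \<beta>' \<beta>"
    "prec (Suc m) Q \<xi> \<tau> \<alpha> \<beta>" "prec (Suc m) Q \<xi> \<tau> \<alpha>' \<beta>'"
    unfolding i1(2) i2(2) i3(2) i4(2) i5(2)
    using path_imp_prec[OF i1(1) i2(1) p12] path_imp_prec[OF i2(1) i3(1) p23]
      path_imp_prec[OF i3(1) i4(1) p34] path_imp_prec[OF i4(1) i5(1) p45]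
      path_imp_prec[OF i1(1) i5(1)] path_imp_prec[OF i2(1) i4(1)]
      rtrancl_trans[OF p34 p23]
      rtrancl_trans[OF p45 rtrancl_trans[OF p34 rtrancl_trans[OF p23 p12]]] su ut st
    by auto
  have pos: "\<alpha> \<in> \<Phi>" "\<beta> \<in> \<Phi>" "\<alpha>' \<in> \<Phi>" "\<beta>' \<in> \<Phi>" "\<gamma> \<in> \<Phi>"
    unfolding i1(2) i2(2) i3(2) i4(2) i5(2)
    by (intro inner_imp_located(2) i1(1) i2(1) i3(1) i4(1) i5(1))+
  have "\<alpha> + \<beta> = E f + E g" "\<alpha>' + \<beta>' = E f + E g"
    using pairs by (auto simp: outer_pair_def inner_pair_def split: if_splits)
  then have rp: "(\<alpha>, \<beta>) \<in> root_pairs (Suc m) Q \<xi> \<tau> \<gamma>" "(\<alpha>', \<beta>') \<in> root_pairs (Suc m) Q \<xi> \<tau> \<gamma>"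
    using pos prec fg(6) by (auto simp: root_pairs_iff)
  have "\<not> minimal_pair (Suc m) Q \<xi> \<tau> R \<gamma> (\<alpha>, \<beta>)" if "compatible (Suc m) Q \<xi> \<tau> R" for R
  proof -
    have "(\<alpha>, \<alpha>') \<in> R" "(\<alpha>', \<gamma>) \<in> R" "(\<gamma>, \<beta>') \<in> R" "(\<beta>', \<beta>) \<in> R"
      using that pos prec unfolding compatible_def by blast+
    then show ?thesis using rp(2) unfolding minimal_pair_def by blast
  qed
  then show ?thesis unfolding pairs non_minimal_pairs_def using rp by blast
qed

text \<open>
  In a linear extension whose interval from \<open>\<alpha>\<close> to \<open>\<beta>\<close> is as small as possible, a pair that
  prevents \<open>(\<alpha>, \<beta>)\<close> from being minimal lies between \<open>\<alpha>\<close> and \<open>\<beta>\<close> in the coordinate order, which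
  \<open>inner_kind_minimal\<close> excludes for all pairs except the outer ones.
\<close>

lemma non_minimal_imp_outer_pair:
  assumes "(\<alpha>, \<beta>) \<in> non_minimal_pairs (Suc m) Q \<xi> \<tau> \<gamma>"
  shows "(\<alpha>, \<beta>) \<in> outer_pair ` {b<..m}"
proof (rule ccontr)
  assume not_outer: "\<not> ?thesis"
  have rp: "(\<alpha>, \<beta>) \<in> root_pairs (Suc m) Q \<xi> \<tau> \<gamma>"
    and nonmin: "\<And>R. compatible (Suc m) Q \<xi> \<tau> R \<Longrightarrow> \<not> minimal_pair (Suc m) Q \<xi> \<tau> R \<gamma> (\<alpha>, \<beta>)"
    using assms unfolding non_minimal_pairs_def by auto
  have "less \<alpha> \<beta>" using rp prec_less by (auto simp: root_pairs_iff)
  obtain R where R: "R \<subseteq> \<Phi> \<times> \<Phi>" "strict_linear_order_on \<Phi> R"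
    "\<forall>x\<in>\<Phi>. \<forall>y\<in>\<Phi>. less x y \<longrightarrow> (x, y) \<in> R"
    "\<forall>x. (\<alpha>, x) \<in> R \<and> (x, \<beta>) \<in> R \<longrightarrow> less \<alpha> x \<and> less x \<beta>"
    by (rule linear_extension_with_interval[of less rank \<alpha> \<beta> \<Phi>,
          OF less_trans less_rank \<open>less \<alpha> \<beta>\<close>])
  have "compatible (Suc m) Q \<xi> \<tau> R" unfolding compatible_def using R prec_less by blast
  from nonmin[OF this] rp obtain \<alpha>' \<beta>' where rp': "(\<alpha>', \<beta>') \<in> root_pairs (Suc m) Q \<xi> \<tau> \<gamma>"
    and ord: "(\<alpha>, \<alpha>') \<in> R" "(\<alpha>', \<gamma>) \<in> R" "(\<gamma>, \<beta>') \<in> R" "(\<beta>', \<beta>) \<in> R"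
    unfolding minimal_pair_def by auto
  have "trans R" using R(2) by (simp add: strict_linear_order_on_def)
  then have "less \<alpha> \<alpha>'" "less \<beta>' \<beta>" using R(4) ord by (meson transD)+
  have "less \<alpha>' \<beta>'" using rp' prec_less by (auto simp: root_pairs_iff)
  obtain k l k' l' where loc: "located \<alpha> k l" "located \<beta> k' l'"
    and kind: "inner_kind (int m) s t k l k' l'"
    using ordered_pair_kinds[of \<alpha> \<beta>] rp \<open>less \<alpha> \<beta>\<close> not_outer unfolding root_pairs_iff by metis
  obtain p q p' q' where loc': "located \<alpha>' p q" "located \<beta>' p' q'"
    and kind': "inner_kind (int m) s t p q p' q' \<or> outer_kind (int m) s t p q p' q'"
    using ordered_pair_kinds[of \<alpha>' \<beta>'] rp' \<open>less \<alpha>' \<beta>'\<close> unfolding root_pairs_iff by metis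
  have "k = p" "l = q"
    using lessD[OF \<open>less \<alpha> \<alpha>'\<close> loc(1) loc'(1)] lessD[OF \<open>less \<beta>' \<beta>\<close> loc'(2) loc(2)]
    by (intro inner_kind_minimal[OF kind kind' st]; auto)+
  then show False using lessD(3)[OF \<open>less \<alpha> \<alpha>'\<close> loc(1) loc'(1)] by simp
qed

lemma inj_on_outer_pair: "inj_on outer_pair {b<..m}"
proof (rule inj_onI)
  fix c d assume cd: "c \<in> {b<..m}" "d \<in> {b<..m}" and eq: "outer_pair c = outer_pair d"
  have "coef c (fst (outer_pair c)) = (if slot g < slot c then -1 else 1)"
    "coef c (fst (outer_pair d)) = (if c = d then if slot g < slot d then -1 else 1 else 0)"
    using cd fg by (auto simp: outer_pair_def coef_linear coef_E)
  then show "c = d" using eq by (auto split: if_splits)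
qed

lemma card_non_minimal_pairs: "card (non_minimal_pairs (Suc m) Q \<xi> \<tau> \<gamma>) = m - b"
proof -
  have "non_minimal_pairs (Suc m) Q \<xi> \<tau> \<gamma> = outer_pair ` {b<..m}"
    using outer_pair_non_minimal non_minimal_imp_outer_pair by (auto simp: image_iff)
  then show ?thesis using card_image[OF inj_on_outer_pair] by simp
qed

end

theorem theorem3p17:
  fixes n a b :: nat and Q :: quiver and \<xi> :: "nat \<Rightarrow> int" and \<tau> :: "vec \<Rightarrow> vec"
  assumes "n \<ge> 4"
    and "dynkin_quiver n Q"
    and "height_function Q \<xi>"
    and "adapted_coxeter n Q \<tau>"
    and "1 \<le> a" and "a < b" and "b \<le> n - 2"
  shows "card (non_minimal_pairs n Q \<xi> \<tau> (eps a + eps b)) = n - b - 1"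
proof -
  obtain m where n: "n = Suc m" using assms(1) by (cases n) auto
  interpret type_D_root m Q \<xi> \<tau> a b
    by unfold_locales (use assms n in auto)
  have "E a = eps a" "E b = eps b" using ab by (auto simp: fun_eq_iff E_def)
  then show ?thesis using card_non_minimal_pairs n by simp
qed

end
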